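(* (i) For every $k \leq 4$, the class of $k$-connected planar graphs is not $T_3$-reconstructible. (ii) The class of 5-connected planar graphs is $T_3$-reconstructible. (iii) For $k \geq 6$ there is no $k$-connected planar graph.
   Context: Graphs are finite, simple, connected and labeled; two labeled graphs are identical iff they have the same vertex set and edge set. $T_3(G)$ is the set of 3-element subsets of $V(G)$ inducing a connected subgraph of $G$. A class $\mathcal{C}$ of graphs is $T_3$-reconstructible if any two distinct labeled graphs $G_1 \neq G_2$ in $\mathcal{C}$ satisfy $T_3(G_1) \neq T_3(G_2)$. *)

theory Defs
  imports "HOL-Analysis.Analysis" "HOL-Library.Infinite_Typeclass"
begin

text \<open>
  A labeled graph is the pair of its vertex set and its edge set, an edge being the set of its two
  endpoints. Equality of pairs is therefore identity of labeled graphs.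
\<close>

type_synonym 'a graph = "'a set \<times> 'a set set"

abbreviation vertices :: "'a graph \<Rightarrow> 'a set" where
  "vertices G \<equiv> fst G"

abbreviation edges :: "'a graph \<Rightarrow> 'a set set" where
  "edges G \<equiv> snd G"

definition finite_simple_graph :: "'a graph \<Rightarrow> bool" where
  "finite_simple_graph G \<longleftrightarrow>
     finite (vertices G) \<and> (\<forall>e\<in>edges G. e \<subseteq> vertices G \<and> card e = 2)"

definition induced_subgraph :: "'a graph \<Rightarrow> 'a set \<Rightarrow> 'a graph" where
  "induced_subgraph G X = (X, {e \<in> edges G. e \<subseteq> X})"

definition adjacency :: "'a graph \<Rightarrow> ('a \<times> 'a) set" where
  "adjacency G = {(u, v). {u, v} \<in> edges G}"

definition connected_graph :: "'a graph \<Rightarrow> bool" where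
  "connected_graph G \<longleftrightarrow>
     vertices G \<noteq> {} \<and> (\<forall>u\<in>vertices G. \<forall>v\<in>vertices G. (u, v) \<in> (adjacency G)\<^sup>*)"

text \<open>
  A \<open>k\<close>-connected graph has more than \<open>k\<close> vertices; without this bound every single vertex
  would be a \<open>k\<close>-connected planar graph for every \<open>k\<close>.
\<close>

definition k_connected :: "nat \<Rightarrow> 'a graph \<Rightarrow> bool" where
  "k_connected k G \<longleftrightarrow>
     k < card (vertices G) \<and>
     (\<forall>X. X \<subseteq> vertices G \<and> card X < k \<longrightarrow>
        connected_graph (induced_subgraph G (vertices G - X)))"

text \<open>
  A drawing in the Euclidean plane (the type \<^typ>\<open>complex\<close>) places the vertices at distinct points
  and represents each edge by a simple arc joining its endpoints, whose interior contains no vertex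
  and no point of another edge.
\<close>

definition plane_drawing ::
  "'a graph \<Rightarrow> ('a \<Rightarrow> complex) \<Rightarrow> ('a set \<Rightarrow> real \<Rightarrow> complex) \<Rightarrow> bool" where
  "plane_drawing G p \<gamma> \<longleftrightarrow>
     inj_on p (vertices G) \<and>
     (\<forall>e\<in>edges G.
        arc (\<gamma> e) \<and>
        {pathstart (\<gamma> e), pathfinish (\<gamma> e)} = p ` e \<and>
        (path_image (\<gamma> e) - p ` e) \<inter> p ` vertices G = {} \<and>
        (\<forall>e'\<in>edges G. e' \<noteq> e \<longrightarrow> (path_image (\<gamma> e) - p ` e) \<inter> path_image (\<gamma> e') = {}))"

definition planar :: "'a graph \<Rightarrow> bool" where
  "planar G \<longleftrightarrow> (\<exists>p \<gamma>. plane_drawing G p \<gamma>)"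

text \<open>
  All graphs are connected by convention. Connectedness is listed separately because it does not
  follow from \<open>k\<close>-connectedness for \<open>k = 0\<close>.
\<close>

definition k_connected_planar_graphs :: "nat \<Rightarrow> 'a graph set" where
  "k_connected_planar_graphs k =
     {G. finite_simple_graph G \<and> connected_graph G \<and> k_connected k G \<and> planar G}"

definition T3 :: "'a graph \<Rightarrow> 'a set set" where
  "T3 G = {X. X \<subseteq> vertices G \<and> card X = 3 \<and> connected_graph (induced_subgraph G X)}"

definition T3_reconstructible :: "'a graph set \<Rightarrow> bool" where
  "T3_reconstructible C \<longleftrightarrow> (\<forall>G\<^sub>1\<in>C. \<forall>G\<^sub>2\<in>C. G\<^sub>1 \<noteq> G\<^sub>2 \<longrightarrow> T3 G\<^sub>1 \<noteq> T3 G\<^sub>2)"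

end

theory Submission
  imports Defs
begin

text \<open>
  (i) The three missing edges of an octahedron form a perfect matching, so every 3-subset of its
  vertices induces at least two edges and \<open>T\<^sub>3\<close> does not see which matching is missing.

  (ii) Let \<open>T\<^sub>3(G) = T\<^sub>3(H)\<close> and let \<open>uv\<close> be an edge of \<open>G\<close> but not of \<open>H\<close>. Every neighbour
  \<open>w \<noteq> v\<close> of \<open>u\<close> in \<open>G\<close> gives a connected triple \<open>uvw\<close>, so in \<open>H\<close> it is adjacent to both \<open>u\<close> and
  \<open>v\<close>. As \<open>u\<close> has degree at least 5 in \<open>G\<close>, this gives four common neighbours of \<open>u\<close> and \<open>v\<close> in
  \<open>H\<close>. Of the four paths \<open>uwv\<close> some two form a closed curve that separates the other two, so
  \<open>u\<close>, \<open>v\<close> and two of the common neighbours form a vertex cut of \<open>H\<close> of size 4.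

  (iii) A 6-connected graph on \<open>n\<close> vertices has at least \<open>3n\<close> edges, a planar one at most
  \<open>3n - 6\<close>. For the latter, finitely many points in pairwise distinct faces replace the set of
  faces, so that the number of faces need not be known to be finite.
\<close>

subsection \<open>Arcs in the plane\<close>

text \<open>An arc is treated as a point set with named ends: the parametrisation and its direction
  are forgotten, so an edge can be used from either endpoint.\<close>

definition arc_between :: "complex set \<Rightarrow> complex \<Rightarrow> complex \<Rightarrow> bool" where
  "arc_between A a b \<longleftrightarrow>
     (\<exists>g. arc g \<and> path_image g = A \<and> pathstart g = a \<and> pathfinish g = b)"

lemma arc_between_sym: "arc_between A a b \<Longrightarrow> arc_between A b a"
  unfolding arc_between_def
  by (metis arc_reversepath path_image_reversepath pathfinish_reversepath pathstart_reversepath)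

lemma arc_between_ends:
  assumes "arc_between A a b"
  shows "a \<in> A" "b \<in> A" "a \<noteq> b"
  using assms arc_distinct_ends pathstart_in_path_image pathfinish_in_path_image
  unfolding arc_between_def by metis+

lemma arc_between_topology:
  assumes "arc_between A a b"
  shows "compact A" "closed A" "connected A" "path_connected A" "connected (- A)"
    "connected (A - {a, b})" "A - {a, b} \<noteq> {}"
proof -
  obtain g where g: "arc g" "path_image g = A" "pathstart g = a" "pathfinish g = b"
    using assms unfolding arc_between_def by blast
  have sp: "simple_path g" using g arc_imp_simple_path by blast
  show "compact A" "closed A" "connected A" "path_connected A" "connected (- A)"
    using g compact_arc_image closed_arc_image connected_arc_image connected_arc_complement[of g]
      path_connected_path_image[OF arc_imp_path[OF g(1)]] by auto
  show "connected (A - {a, b})" using connected_simple_path_endless[OF sp] g by simp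
  show "A - {a, b} \<noteq> {}" using simple_path_endless[OF sp] g
    by (metis empty_is_image greaterThanLessThan_empty_iff2 not_one_le_zero)
qed

text \<open>The inverse of the parametrisation would embed a nonempty open set of the plane in the
  real line, against invariance of dimension.\<close>

lemma interior_arc_between:
  assumes "arc_between A a b"
  shows "interior A = {}"
proof (rule ccontr)
  assume ne: "interior A \<noteq> {}"
  obtain g where g: "arc g" "path_image g = A"
    using assms unfolding arc_between_def by blast
  obtain h where h: "homeomorphism {0..1} A g h"
    using homeomorphism_arc[OF g(1)] g(2) by blast
  have "continuous_on (interior A) h" "inj_on h (interior A)"
    using h interior_subset[of A] unfolding homeomorphism_def
    by (meson continuous_on_subset, metis (no_types, lifting) inj_on_inverseI subset_iff)
  then have "DIM(complex) \<le> DIM(real)"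
    using invariance_of_dimension[of "interior A" h] ne by auto
  then show False by simp
qed

lemma arc_between_join:
  assumes "arc_between A a b" "arc_between B b c" "A \<inter> B = {b}"
  shows "arc_between (A \<union> B) a c"
proof -
  obtain g where g: "arc g" "path_image g = A" "pathstart g = a" "pathfinish g = b"
    using assms unfolding arc_between_def by blast
  obtain h where h: "arc h" "path_image h = B" "pathstart h = b" "pathfinish h = c"
    using assms unfolding arc_between_def by blast
  have "arc (g +++ h)" using g h assms by (intro arc_join) auto
  then show ?thesis unfolding arc_between_def
    using g h by (metis path_image_join pathfinish_join pathstart_join)
qed

section \<open>Jordan curves and theta curves\<close>

text \<open>\<open>A\<close> forwards and \<open>B\<close> backwards form a simple closed curve, to
  which the Jordan curve theorem applies. The result is symmetric in \<open>U\<close> and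
  \<open>V\<close>, because it never matters which side is bounded.\<close>

lemma jordan_curve_arcs:
  assumes A: "arc_between A a b" and B: "arc_between B a b" and AB: "A \<inter> B = {a, b}"
  obtains U V where "U \<noteq> {}" "V \<noteq> {}" "connected U" "connected V" "open U" "open V"
    "U \<inter> V = {}" "U \<union> V = - (A \<union> B)" "frontier U = A \<union> B" "frontier V = A \<union> B"
proof -
  obtain g where g: "arc g" "path_image g = A" "pathstart g = a" "pathfinish g = b"
    using A unfolding arc_between_def by blast
  obtain h where h: "arc h" "path_image h = B" "pathstart h = b" "pathfinish h = a"
    using arc_between_sym[OF B] unfolding arc_between_def by blast
  have *: "simple_path (g +++ h)" "pathfinish (g +++ h) = pathstart (g +++ h)"
    "path_image (g +++ h) = A \<union> B"
    using g h AB by (auto intro!: simple_path_join_loop simp: path_image_join)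
  show ?thesis
    using Jordan_inside_outside[OF *(1,2)] that unfolding *(3) by blast
qed

text \<open>This names the side away from \<open>x\<close>. Describing membership through components
  of the complement makes the far sides of different closed curves comparable.\<close>

lemma jordan_other_side:
  assumes "arc_between A a b" "arc_between B a b" "A \<inter> B = {a, b}" "x \<notin> A \<union> B"
  obtains Y where "Y \<noteq> {}" "open Y" "connected Y" "Y \<inter> (A \<union> B) = {}" "frontier Y = A \<union> B"
    "\<And>y. y \<notin> A \<union> B \<Longrightarrow> y \<in> Y \<longleftrightarrow> \<not> connected_component (- (A \<union> B)) x y"
proof -
  note result = that
  have main: thesis
    if UV: "U \<noteq> {}" "V \<noteq> {}" "connected U" "connected V" "open U" "open V"
      "U \<inter> V = {}" "U \<union> V = - (A \<union> B)" "frontier U = A \<union> B" "x \<in> V" for U V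
  proof (rule result[of U])
    fix y assume y: "y \<notin> A \<union> B"
    show "y \<in> U \<longleftrightarrow> \<not> connected_component (- (A \<union> B)) x y"
    proof
      assume "y \<in> U"
      show "\<not> connected_component (- (A \<union> B)) x y"
      proof
        assume "connected_component (- (A \<union> B)) x y"
        then obtain T where "connected T" "T \<subseteq> - (A \<union> B)" "x \<in> T" "y \<in> T"
          unfolding connected_component_def by blast
        then show False
          using connectedD[of T U V] UV \<open>y \<in> U\<close> by blast
      qed
    next
      assume "\<not> connected_component (- (A \<union> B)) x y"
      then have "y \<notin> V"
        using UV unfolding connected_component_def by blast
      then show "y \<in> U" using UV y by blast
    qed
  qed (use UV in auto)
  obtain U V where "U \<noteq> {}" "V \<noteq> {}" "connected U" "connected V" "open U" "open V"
    "U \<inter> V = {}" "U \<union> V = - (A \<union> B)" "frontier U = A \<union> B" "frontier V = A \<union> B"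
    by (rule jordan_curve_arcs[OF assms(1-3)])
  then show thesis
    using main[of U V] main[of V U] assms(4)
    by (metis (no_types, lifting) Compl_iff UnE inf_commute sup_commute)
qed

text \<open>
  If not, pick \<open>a0\<close> on the side of \<open>A \<union> B\<close> that contains neither \<open>x\<close> nor \<open>C\<close>. Comparing frontiers,
  \<open>a0\<close> lies on the side of \<open>x\<close> for the two other curves, and these meet in the connected set \<open>C\<close>,
  so Janiszewski's theorem connects \<open>a0\<close> to \<open>x\<close> off all three arcs.
\<close>

lemma theta_separates:
  assumes A: "arc_between A a b" and B: "arc_between B a b" and C: "arc_between C a b"
    and AB: "A \<inter> B = {a, b}" and AC: "A \<inter> C = {a, b}" and BC: "B \<inter> C = {a, b}"
    and q: "q1 \<in> A - {a, b}" "q2 \<in> B - {a, b}" "q3 \<in> C - {a, b}"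
    and x: "x \<notin> A \<union> B \<union> C"
  shows "\<not> connected_component (- (A \<union> B)) x q3 \<or> \<not> connected_component (- (A \<union> C)) x q2 \<or>
    \<not> connected_component (- (B \<union> C)) x q1"
proof (rule ccontr)
  assume "\<not> ?thesis"
  then have cc: "connected_component (- (A \<union> B)) x q3" "connected_component (- (A \<union> C)) x q2"
    "connected_component (- (B \<union> C)) x q1" by auto
  \<comment> \<open>Without its ends, \<open>R\<close> is connected and misses
    \<open>P \<union> Q\<close>, so it lies entirely on the side of \<open>r\<close>. That is the
    side of \<open>x\<close>, whereas \<open>Y\<close> is the other one.\<close>
  have arc_avoid: "Y \<inter> R = {}"
    if R: "arc_between R a b" "R \<inter> (P \<union> Q) = {a, b}" "r \<in> R - {a, b}" 
      and cr: "connected_component (- (P \<union> Q)) x r" and ab: "{a, b} \<subseteq> P"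
      and Y: "Y \<inter> (P \<union> Q) = {}" "\<And>y. y \<notin> P \<union> Q \<Longrightarrow> y \<in> Y \<longleftrightarrow> \<not> connected_component (- (P \<union> Q)) x y"
    for P Q R r Y
  proof -
    have "connected_component (- (P \<union> Q)) x y" if "y \<in> R - {a, b}" for y
    proof -
      have "connected_component (- (P \<union> Q)) r y"
        unfolding connected_component_def
        using arc_between_topology(6)[OF R(1)] R that by (intro exI[of _ "R - {a, b}"]) auto
      then show ?thesis using cr connected_component_trans by metis
    qed
    then show ?thesis using Y ab R by blast
  qed
  obtain Y where Y: "Y \<noteq> {}" "open Y" "connected Y" "Y \<inter> (A \<union> B) = {}" "frontier Y = A \<union> B"
    "\<And>y. y \<notin> A \<union> B \<Longrightarrow> y \<in> Y \<longleftrightarrow> \<not> connected_component (- (A \<union> B)) x y"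
    using jordan_other_side[OF A B AB] x by (metis UnI1)
  have YC: "Y \<inter> C = {}"
    by (rule arc_avoid[OF C _ q(3) cc(1) _ Y(4,6)]) (use AB AC BC in auto)
  obtain a0 where a0: "a0 \<in> Y" using Y by blast
  have *: "connected_component (- (P \<union> C)) x a0"
    if P: "arc_between P a b" "P \<inter> C = {a, b}" "P \<union> Q = A \<union> B" "arc_between Q a b" "r \<in> Q - {a, b}"
       "Q \<inter> (P \<union> C) = {a, b}" "connected_component (- (P \<union> C)) x r" for P Q r
  proof (rule ccontr)
    \<comment> \<open>If \<open>P \<union> C\<close> also cuts \<open>a0\<close> off from
      \<open>x\<close>, the two far sides \<open>Y\<close> and \<open>Z\<close> coincide. Then so do
      their frontiers \<open>A \<union> B\<close> and \<open>P \<union> C\<close>, but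
      \<open>r\<close> lies only on the first.\<close>
    assume nc: "\<not> connected_component (- (P \<union> C)) x a0"
    have xPC: "x \<notin> P \<union> C" using x P(3) by blast
    obtain Z where Z: "Z \<noteq> {}" "open Z" "connected Z" "Z \<inter> (P \<union> C) = {}" "frontier Z = P \<union> C"
      "\<And>y. y \<notin> P \<union> C \<Longrightarrow> y \<in> Z \<longleftrightarrow> \<not> connected_component (- (P \<union> C)) x y"
      using jordan_other_side[OF P(1) C P(2) xPC] by metis
    have ZQ: "Z \<inter> Q = {}"
      by (rule arc_avoid[OF P(4) P(6) P(5) P(7) _ Z(4,6)]) (use P in auto)
    have YPC: "Y \<inter> (P \<union> C) = {}" using Y(4) YC P(3) by blast
    have a0PC: "a0 \<notin> P \<union> C" using a0 YPC by blast
    have "Y \<subseteq> Z"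
    proof
      fix y assume y: "y \<in> Y"
      have "connected_component (- (P \<union> C)) y a0"
        unfolding connected_component_def using Y(3) YPC y a0 by blast
      then have "\<not> connected_component (- (P \<union> C)) x y"
        using nc connected_component_trans by metis
      then show "y \<in> Z" using Z(6) y YPC by blast
    qed
    moreover have "Z \<subseteq> Y"
    proof
      fix z assume z: "z \<in> Z"
      have a0Z: "a0 \<in> Z" using Z(6)[OF a0PC] nc by simp
      have ZAB: "Z \<inter> (A \<union> B) = {}" using Z(4) ZQ P(3) by blast
      have "connected_component (- (A \<union> B)) z a0"
        unfolding connected_component_def using Z(3) ZAB z a0Z by blast
      moreover have "\<not> connected_component (- (A \<union> B)) x a0" using Y(4,6) a0 by blast
      ultimately have "\<not> connected_component (- (A \<union> B)) x z"
        using connected_component_trans by metis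
      then show "z \<in> Y" using Y(6) z ZAB by blast
    qed
    ultimately have "A \<union> B = P \<union> C" using Y(5) Z(5) by simp
    then show False using P(3,5,6) by blast
  qed
  have 1: "connected_component (- (A \<union> C)) x a0"
    by (rule *[OF A AC _ B q(2) _ cc(2)]) (use AB BC in auto)
  have 2: "connected_component (- (B \<union> C)) x a0"
    by (rule *[OF B BC _ A q(1) _ cc(3)]) (use AB AC in auto)
  have "(A \<union> C) \<inter> (B \<union> C) = C"
    using AB arc_between_ends[OF C] by (simp add: Un_Int_distrib2[symmetric] insert_absorb)
  then have "connected_component (- ((A \<union> C) \<union> (B \<union> C))) x a0"
    using Janiszewski[OF _ _ _ 1 2] arc_between_topology[OF A] arc_between_topology[OF B]
      arc_between_topology[OF C] by (simp add: compact_Un closed_Un)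
  then have "connected_component (- (A \<union> B)) x a0"
    by (rule connected_component_of_subset) auto
  then show False using Y(4,6) a0 by blast
qed

section \<open>Faces represented by points\<close>

definition in_distinct_faces :: "complex set \<Rightarrow> complex set \<Rightarrow> bool" where
  "in_distinct_faces K X \<longleftrightarrow>
     finite X \<and> X \<inter> K = {} \<and> pairwise (\<lambda>x y. \<not> connected_component (- K) x y) X"

text \<open>The component of \<open>x\<close> off \<open>K\<close> is open and nonempty, so an arc,
  having empty interior, cannot cover it.\<close>

lemma perturb_off_arc:
  assumes "closed K" "arc_between A a b" "x \<notin> K"
  shows "\<exists>y. y \<notin> K \<union> A \<and> connected_component (- K) x y"
proof -
  have "open (connected_component_set (- K) x)" using assms by (simp add: open_connected_component open_Compl)
  moreover have "x \<in> connected_component_set (- K) x" using assms by simp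
  ultimately have "\<not> connected_component_set (- K) x \<subseteq> A"
    using interior_arc_between[OF assms(2)] interior_maximal by blast
  then obtain y where "connected_component (- K) x y" "y \<notin> A" by blast
  then show ?thesis using connected_component_in by blast
qed

text \<open>A new arc may run through some representatives, so each is moved within its old face.
  Enlarging \<open>K\<close> only refines the faces, hence the moved points stay in different
  ones.\<close>

lemma in_distinct_faces_perturb:
  assumes "closed K" "arc_between A a b" "in_distinct_faces K X"
  shows "\<exists>f. in_distinct_faces (K \<union> A) (f ` X) \<and> inj_on f X \<and>
    (\<forall>x\<in>X. connected_component (- K) x (f x))"
proof -
  have "\<forall>x\<in>X. \<exists>y. y \<notin> K \<union> A \<and> connected_component (- K) x y"
    using perturb_off_arc[OF assms(1,2)] assms(3) unfolding in_distinct_faces_def by blast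
  then obtain f where f: "\<And>x. x \<in> X \<Longrightarrow> f x \<notin> K \<union> A \<and> connected_component (- K) x (f x)"
    by metis
  have sep: "\<not> connected_component (- K) (f x) (f y)" if "x \<in> X" "y \<in> X" "x \<noteq> y" for x y
    using that f[of x] f[of y] assms(3) unfolding in_distinct_faces_def pairwise_def
    by (metis connected_component_sym connected_component_trans)
  have inj: "inj_on f X"
    using sep f by (metis Compl_iff UnI1 connected_component_refl inj_onI)
  have "pairwise (\<lambda>x y. \<not> connected_component (- (K \<union> A)) x y) (f ` X)"
    unfolding pairwise_def
  proof clarsimp
    fix x y assume "x \<in> X" "y \<in> X" "f x \<noteq> f y" "connected_component (- K \<inter> - A) (f x) (f y)"
    then show False using sep[of x y] connected_component_of_subset[of "- K \<inter> - A" _ _ "- K"] by blast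
  qed
  then show ?thesis
    using inj f assms(3) unfolding in_distinct_faces_def by (intro exI[of _ f]) auto
qed

text \<open>An arc \<open>P\<close> inside \<open>K\<close> closes the chord to a Jordan curve. Both
  sides of it come arbitrarily close to an inner point \<open>z\<close> of the chord, and a small
  ball around \<open>z\<close> misses \<open>K\<close>; one point of each side is taken from this
  ball.\<close>

lemma chord_separates:
  assumes K: "closed K" "path_connected K" and A: "arc_between A a b" and KA: "K \<inter> A = {a, b}"
  shows "\<exists>x y. x \<notin> K \<union> A \<and> y \<notin> K \<union> A \<and> connected_component (- K) x y \<and>
    \<not> connected_component (- (K \<union> A)) x y"
proof -
  obtain P where P: "arc_between P a b" "P \<subseteq> K"
    using K(2) KA arc_between_ends(3)[OF A] unfolding path_connected_arcwise arc_between_def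
    by (metis IntD1 insertCI)
  have AP: "A \<inter> P = {a, b}" using KA P arc_between_ends[OF P(1)] by blast
  obtain U V where UV: "U \<noteq> {}" "V \<noteq> {}" "connected U" "connected V" "open U" "open V"
    "U \<inter> V = {}" "U \<union> V = - (A \<union> P)" "frontier U = A \<union> P" "frontier V = A \<union> P"
    by (rule jordan_curve_arcs[OF A P(1) AP])
  obtain z where z: "z \<in> A - {a, b}" using arc_between_topology(7)[OF A] by blast
  then have "z \<in> - K" using KA by blast
  then obtain r where r: "r > 0" "ball z r \<subseteq> - K"
    using K(1) open_Compl open_contains_ball by metis
  have "z \<in> closure U" "z \<in> closure V" using z UV(9,10) unfolding frontier_def by blast+
  then obtain x y where xy: "x \<in> U" "x \<in> ball z r" "y \<in> V" "y \<in> ball z r"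
    using r(1) unfolding closure_approachable by (metis dist_commute mem_ball)
  have "connected_component (- K) x y"
    unfolding connected_component_def using r(2) xy connected_ball by blast
  moreover have "x \<notin> K \<union> A" "y \<notin> K \<union> A" using r(2) xy UV by blast+
  moreover have "\<not> connected_component (- (K \<union> A)) x y"
  proof
    assume "connected_component (- (K \<union> A)) x y"
    then obtain T where T: "connected T" "T \<subseteq> - (K \<union> A)" "x \<in> T" "y \<in> T"
      unfolding connected_component_def by blast
    then have "T \<subseteq> U \<union> V" using P UV by blast
    then show False using connectedD[OF T(1) UV(5,6)] UV(7) T xy by blast
  qed
  ultimately show ?thesis by blast
qed

text \<open>The chord splits a face of \<open>K\<close> between \<open>x\<close> and
  \<open>y\<close>. At most one representative lies in that face; it is dropped and both
  \<open>x\<close> and \<open>y\<close> are added, a net gain of at least one.\<close>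

lemma in_distinct_faces_add_chord:
  assumes K: "closed K" "path_connected K" and A: "arc_between A a b" and KA: "K \<inter> A = {a, b}"
    and X: "in_distinct_faces K X"
  shows "\<exists>Y. in_distinct_faces (K \<union> A) Y \<and> card X < card Y"
proof -
  obtain x y where xy: "x \<notin> K \<union> A" "y \<notin> K \<union> A" "connected_component (- K) x y"
    "\<not> connected_component (- (K \<union> A)) x y"
    using chord_separates[OF K A KA] by blast
  obtain f where f: "in_distinct_faces (K \<union> A) (f ` X)" "inj_on f X"
    "\<forall>x\<in>X. connected_component (- K) x (f x)"
    using in_distinct_faces_perturb[OF K(1) A X] by blast
  define X' where "X' = {t \<in> X. \<not> connected_component (- K) t x}"
  define Y where "Y = insert x (insert y (f ` X'))"
  have sub: "connected_component (- (K \<union> A)) s t \<Longrightarrow> connected_component (- K) s t" for s t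
    by (rule connected_component_of_subset) auto
  have fin: "finite X" using X unfolding in_distinct_faces_def by blast
  have far: "\<not> connected_component (- K) (f t) x \<and> \<not> connected_component (- K) (f t) y"
    if "t \<in> X'" for t
    using that f(3) xy(3) unfolding X'_def
    by (metis (no_types, lifting) connected_component_sym connected_component_trans mem_Collect_eq)
  have xyK: "connected_component (- K) x x" "connected_component (- K) y y"
    using xy by auto
  have notin: "x \<notin> insert y (f ` X')" "y \<notin> f ` X'"
  proof -
    have "x \<noteq> y" using xy by auto
    then show "x \<notin> insert y (f ` X')" "y \<notin> f ` X'" using far xyK by fastforce+
  qed
  have "in_distinct_faces (K \<union> A) Y"
    unfolding in_distinct_faces_def
  proof (intro conjI)
    show "finite Y" using fin unfolding Y_def X'_def by simp
    show "Y \<inter> (K \<union> A) = {}"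
      using xy f(1) unfolding Y_def X'_def in_distinct_faces_def by blast
    have "pairwise (\<lambda>x y. \<not> connected_component (- (K \<union> A)) x y) (f ` X')"
      using f(1) unfolding in_distinct_faces_def X'_def by (metis (no_types, lifting) image_mono mem_Collect_eq pairwise_subset subsetI)
    then show "pairwise (\<lambda>x y. \<not> connected_component (- (K \<union> A)) x y) Y"
      unfolding Y_def pairwise_insert using xy(4) far sub connected_component_sym by (smt (verit, best) imageE insertE)
  qed
  moreover have "card X < card Y"
  proof -
    have "\<exists>s. X \<subseteq> insert s X'"
    proof (cases "\<exists>s\<in>X. connected_component (- K) s x")
      case True
      then obtain s where s: "s \<in> X" "connected_component (- K) s x" by blast
      then have "X \<subseteq> insert s X'"
        using X unfolding X'_def in_distinct_faces_def pairwise_def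
        by (smt (verit) connected_component_sym connected_component_trans insert_iff mem_Collect_eq subsetI)
      then show ?thesis by blast
    next
      case False
      then show ?thesis unfolding X'_def by blast
    qed
    then obtain s where "X \<subseteq> insert s X'" by blast
    then have "card X \<le> card (insert s X')"
      using fin unfolding X'_def by (intro card_mono) auto
    also have "\<dots> \<le> card X' + 1" by (simp add: fin X'_def card_insert_if)
    finally have "card X \<le> card X' + 1" .
    moreover have "card X' = card (f ` X')"
      using f(2) unfolding X'_def by (metis (no_types, lifting) card_image inj_on_subset mem_Collect_eq subsetI)
    moreover have "card Y = card (f ` X') + 2"
      using notin fin unfolding Y_def X'_def by simp
    ultimately show ?thesis by simp
  qed
  ultimately show ?thesis by blast
qed

text \<open>
  Of three faces touching the chord, two lie on the same side of a closed curve formed by the chord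
  and an arc in \<open>K\<close>. They are also connected through the chord off \<open>K\<close>, so Janiszewski's theorem
  identifies them.
\<close>

lemma chord_meets_two_faces:
  assumes K: "closed K" "path_connected K" and A: "arc_between A a b" and KA: "K \<inter> A = {a, b}"
    and X: "in_distinct_faces (K \<union> A) X"
    and touch: "\<And>x. x \<in> X \<Longrightarrow> closure (connected_component_set (- (K \<union> A)) x) \<inter> (A - {a, b}) \<noteq> {}"
  shows "card X \<le> 2"
proof (rule ccontr)
  assume "\<not> card X \<le> 2"
  then obtain T where "T \<subseteq> X" "card T = 3" by (metis not_less_eq_eq numeral_2_eq_2 numeral_3_eq_3 obtain_subset_with_card_n)
  then obtain x y z where xyz: "x \<in> X" "y \<in> X" "z \<in> X" "x \<noteq> y" "y \<noteq> z" "x \<noteq> z"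
    unfolding card_3_iff by auto
  let ?F = "connected_component_set (- (K \<union> A))"
  obtain P where P: "arc_between P a b" "P \<subseteq> K"
    using K(2) KA arc_between_ends(3)[OF A] unfolding path_connected_arcwise arc_between_def
    by (metis IntD1 insertCI)
  have AP: "A \<inter> P = {a, b}" using KA P arc_between_ends[OF P(1)] by blast
  have sep: "\<not> connected_component (- (A \<union> P)) s t" if st: "s \<in> X" "t \<in> X" "s \<noteq> t" for s t
  proof
    assume 1: "connected_component (- (A \<union> P)) s t"
    \<comment> \<open>The face of \<open>u\<close> remains connected after adding a closure point
      \<open>w\<close> on the open chord, and then the whole open chord. The result misses
      \<open>K\<close>, so any two such faces are joined off \<open>K\<close>.\<close>
    have F: "\<exists>T. connected T \<and> u \<in> T \<and> A - {a, b} \<subseteq> T \<and> T \<subseteq> - K" if u: "u \<in> X" for u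
    proof -
      obtain w where w: "w \<in> closure (?F u)" "w \<in> A - {a, b}" using touch[OF u] by blast
      have "u \<in> ?F u" using u X unfolding in_distinct_faces_def by auto
      moreover have "connected (insert w (?F u))"
        by (rule connected_intermediate_closure[of "?F u"]) (use w closure_subset in fast)+
      then have "connected (insert w (?F u) \<union> (A - {a, b}))"
        using w arc_between_topology(6)[OF A] by (intro connected_Un) auto
      moreover have "insert w (?F u) \<union> (A - {a, b}) \<subseteq> - K"
        using w KA connected_component_subset[of "- (K \<union> A)" u] by blast
      ultimately show ?thesis by blast
    qed
    obtain S where S: "connected S" "s \<in> S" "A - {a, b} \<subseteq> S" "S \<subseteq> - K" using F[OF st(1)] by blast
    obtain T where T: "connected T" "t \<in> T" "A - {a, b} \<subseteq> T" "T \<subseteq> - K" using F[OF st(2)] by blast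
    have "connected (S \<union> T)"
      using S T arc_between_topology(7)[OF A] by (intro connected_Un) auto
    then have 2: "connected_component (- K) s t"
      unfolding connected_component_def using S T by blast
    have "(A \<union> P) \<inter> K = (K \<inter> A) \<union> P" using P by blast
    also have "\<dots> = P" using KA arc_between_ends[OF P(1)] by (simp add: insert_absorb)
    finally have "(A \<union> P) \<inter> K = P" .
    then have "connected_component (- ((A \<union> P) \<union> K)) s t"
      using Janiszewski[OF _ K(1) _ 1 2] arc_between_topology[OF A] arc_between_topology[OF P(1)]
      by (simp add: compact_Un)
    moreover have "(A \<union> P) \<union> K = K \<union> A" using P by blast
    ultimately show False using X st unfolding in_distinct_faces_def pairwise_def by simp
  qed
  have off: "t \<notin> A \<union> P" if "t \<in> X" for t
    using that X P unfolding in_distinct_faces_def by blast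
  \<comment> \<open>There is only one side away from \<open>x\<close>, so \<open>y\<close> and
    \<open>z\<close> share it, against \<open>sep\<close>.\<close>
  obtain Y where Y: "connected Y" "Y \<inter> (A \<union> P) = {}"
    "\<And>y. y \<notin> A \<union> P \<Longrightarrow> y \<in> Y \<longleftrightarrow> \<not> connected_component (- (A \<union> P)) x y"
    using jordan_other_side[OF A P(1) AP off[OF xyz(1)]] by metis
  have "y \<in> Y" "z \<in> Y" using Y(3) off sep xyz by blast+
  then have "connected_component (- (A \<union> P)) y z"
    unfolding connected_component_def using Y by blast
  then show False using sep xyz by blast
qed

text \<open>The points are removed one at a time by Janiszewski's theorem: a single point meets any
  set in a connected set.\<close>

lemma connected_Compl_finite_Un:
  fixes D :: "complex set"
  assumes "finite W" "closed D" "connected (- D)"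
  shows "connected (- (W \<union> D))"
  using assms(1)
proof induction
  case empty
  then show ?case using assms by simp
next
  case (insert w W)
  have "connected (- ({w} \<union> (W \<union> D)))"
  proof (rule Janiszewski_connected)
    show "connected ({w} \<inter> (W \<union> D))" by (metis Int_insert_left_if0 Int_insert_left_if1 Int_empty_left connected_empty connected_sing)
    show "connected (- {w})" by (simp add: connected_punctured_universe)
  qed (use insert assms in \<open>auto simp: finite_imp_closed\<close>)
  then show ?case by simp
qed

text \<open>By Janiszewski's theorem two arcs with connected intersection do not separate the plane,
  and finitely many further points change nothing. A connected set that meets the face but not its
  frontier lies inside the face, so the face contains everything off these arcs and points. As it
  misses \<open>K\<close>, nothing of \<open>K\<close> lies elsewhere.\<close>

lemma face_boundary_not_two_arcs:
  assumes K: "closed K" "x \<notin> K" and W: "finite W" "W \<subseteq> K"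
    and A: "arc_between A a b" "A \<subseteq> K" and B: "arc_between B c d" "B \<subseteq> K" and AB: "connected (A \<inter> B)"
    and fr: "frontier (connected_component_set (- K) x) \<subseteq> W \<union> (A \<union> B)"
  shows "K \<subseteq> W \<union> (A \<union> B)"
proof -
  let ?F = "connected_component_set (- K) x"
  let ?D = "W \<union> (A \<union> B)"
  have "connected (- (A \<union> B))"
    using Janiszewski_connected[of A B] AB arc_between_topology[OF A(1)] arc_between_topology[OF B(1)] by blast
  then have "connected (- ?D)"
    using connected_Compl_finite_Un[OF W(1)] closed_Un[OF arc_between_topology(2)[OF A(1)]
      arc_between_topology(2)[OF B(1)]] by blast
  moreover have "?F \<subseteq> - ?D" using connected_component_subset[of "- K" x] W A B by blast
  moreover have "x \<in> ?F" using K by simp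
  moreover have "open ?F" using K by (simp add: open_connected_component open_Compl)
  ultimately have "- ?D \<subseteq> ?F"
    using connected_Int_frontier[of "- ?D" ?F] fr by blast
  then show ?thesis using connected_component_subset[of "- K" x] by blast
qed

subsection \<open>Connectivity\<close>

lemma edge_in_vertices:
  assumes "finite_simple_graph G" "{u, v} \<in> edges G"
  shows "u \<in> vertices G" "v \<in> vertices G" "u \<noteq> v"
proof -
  have "{u, v} \<subseteq> vertices G" "card {u, v} = 2"
    using assms unfolding finite_simple_graph_def by blast+
  then show "u \<in> vertices G" "v \<in> vertices G" "u \<noteq> v" by auto
qed

lemma finite_edges: "finite_simple_graph G \<Longrightarrow> finite (edges G)"
  unfolding finite_simple_graph_def by (meson PowI finite_Pow_iff finite_subset subsetI)

lemma sym_adjacency: "sym (adjacency G)"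
  unfolding adjacency_def sym_def by (simp add: insert_commute)

lemma adjacency_induced_subgraph:
  "(u, v) \<in> adjacency (induced_subgraph G X) \<longleftrightarrow> {u, v} \<in> edges G \<and> u \<in> X \<and> v \<in> X"
  unfolding adjacency_def induced_subgraph_def by auto

lemma connected_graph_edge_leaving:
  assumes "connected_graph G" "s \<in> S" "S \<subseteq> vertices G" "t \<in> vertices G" "t \<notin> S"
  obtains u v where "u \<in> S" "v \<notin> S" "{u, v} \<in> edges G"
proof -
  have "(s, t) \<in> (adjacency G)\<^sup>*" using assms unfolding connected_graph_def by blast
  then have "\<exists>u v. u \<in> S \<and> v \<notin> S \<and> {u, v} \<in> edges G"
    using assms(5)
  proof (induction rule: rtrancl_induct)
    case base
    then show ?case using assms(2) by simp
  next
    case (step y z)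
    then show ?case unfolding adjacency_def by blast
  qed
  then show thesis using that by blast
qed

text \<open>Deleting fewer than \<open>k\<close> neighbours would isolate \<open>v\<close>, while
  the bound on the number of vertices guarantees another survivor.\<close>

lemma k_connected_degree:
  assumes G: "finite_simple_graph G" "k_connected k G" "v \<in> vertices G"
  shows "k \<le> card {w. {v, w} \<in> edges G}"
proof (rule ccontr)
  define N where "N = {w. {v, w} \<in> edges G}"
  assume "\<not> k \<le> card {w. {v, w} \<in> edges G}"
  then have N: "card N < k" unfolding N_def by linarith
  have sub: "N \<subseteq> vertices G" "v \<notin> N" unfolding N_def using edge_in_vertices[OF G(1)] by blast+
  have fin: "finite (vertices G)" using G unfolding finite_simple_graph_def by blast
  let ?H = "induced_subgraph G (vertices G - N)"
  have con: "connected_graph ?H"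
    using k_connected_def[THEN iffD1, OF G(2), THEN conjunct2, rule_format, of N] N sub(1) by simp
  have "card (insert v N) \<le> k" using N finite_subset[OF sub(1) fin] sub(2) by simp
  also have "k < card (vertices G)" using G(2) unfolding k_connected_def by blast
  finally have "\<not> vertices G \<subseteq> insert v N"
    using card_mono[of "insert v N" "vertices G"] finite_subset[OF sub(1) fin] by auto
  then obtain t where t: "t \<in> vertices G" "t \<notin> insert v N" by blast
  have V: "vertices ?H = vertices G - N" unfolding induced_subgraph_def by simp
  obtain u w where "u \<in> {v}" "w \<notin> {v}" "{u, w} \<in> edges ?H"
    by (rule connected_graph_edge_leaving[OF con, of v "{v}" t]) (use t sub G(3) V in auto)
  then have "w \<in> N" "w \<in> vertices G - N" unfolding induced_subgraph_def N_def by auto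
  then show False by blast
qed

lemma k_connected_mono: "k_connected k G \<Longrightarrow> j \<le> k \<Longrightarrow> k_connected j G"
  unfolding k_connected_def by auto

text \<open>An endpoint \<open>u\<close> of \<open>e\<close> keeps another neighbour
  \<open>w\<close>, and the graph without \<open>u\<close> is connected and does not use
  \<open>e\<close>.\<close>

lemma connected_graph_delete_edge:
  assumes G: "finite_simple_graph G" "k_connected 2 G" and e: "e \<in> edges G"
  shows "connected_graph (vertices G, edges G - {e})"
proof -
  let ?A = "adjacency (vertices G, edges G - {e})"
  have "card e = 2" using G(1) e unfolding finite_simple_graph_def by blast
  then obtain u v where uv: "e = {u, v}" "u \<noteq> v" by (meson card_2_iff)
  then have u: "u \<in> vertices G" using edge_in_vertices[OF G(1)] e by blast
  have "\<not> {w. {u, w} \<in> edges G} \<subseteq> {v}"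
    using k_connected_degree[OF G u] card_mono[of "{v}" "{w. {u, w} \<in> edges G}"] by auto
  then obtain w where w: "{u, w} \<in> edges G" "w \<noteq> v" by blast
  have uw: "(u, w) \<in> ?A" using w uv edge_in_vertices(3)[OF G(1) w(1)]
    unfolding adjacency_def by (auto simp: doubleton_eq_iff)
  have con: "connected_graph (induced_subgraph G (vertices G - {u}))"
    using G(2) u unfolding k_connected_def by simp
  have "adjacency (induced_subgraph G (vertices G - {u})) \<subseteq> ?A"
    unfolding adjacency_def induced_subgraph_def using uv by auto
  then have sub: "(adjacency (induced_subgraph G (vertices G - {u})))\<^sup>* \<subseteq> ?A\<^sup>*"
    by (rule rtrancl_mono)
  have wx: "(w, x) \<in> ?A\<^sup>*" if "x \<in> vertices G" for x
  proof (cases "x = u")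
    case True
    then show ?thesis using uw sym_adjacency[of "(vertices G, edges G - {e})"] by (meson r_into_rtrancl symE)
  next
    case False
    then have "(w, x) \<in> (adjacency (induced_subgraph G (vertices G - {u})))\<^sup>*"
      using con that edge_in_vertices[OF G(1) w(1)] unfolding connected_graph_def induced_subgraph_def by simp
    then show ?thesis using sub by blast
  qed
  have "(x, y) \<in> ?A\<^sup>*" if "x \<in> vertices G" "y \<in> vertices G" for x y
    using wx[OF that(1)] wx[OF that(2)] sym_rtrancl[OF sym_adjacency[of "(vertices G, edges G - {e})"]]
    by (meson rtrancl_trans symE)
  then show ?thesis using u unfolding connected_graph_def by auto
qed

subsection \<open>Plane drawings\<close>

locale plane_graph =
  fixes G :: "'a graph" and p :: "'a \<Rightarrow> complex" and \<gamma> :: "'a set \<Rightarrow> real \<Rightarrow> complex"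
  assumes simple: "finite_simple_graph G" and drawing: "plane_drawing G p \<gamma>"
begin

definition edge_arc :: "'a set \<Rightarrow> complex set" where
  "edge_arc e = path_image (\<gamma> e)"

text \<open>Vertices and edges are parameters because subgraphs are drawn too: the face count grows
  a subgraph edge by edge, and the edge count removes a single edge.\<close>

definition drawn :: "'a set \<Rightarrow> 'a set set \<Rightarrow> complex set" where
  "drawn V E = p ` V \<union> (\<Union>e\<in>E. edge_arc e)"

lemma finite_vertices: "finite (vertices G)"
  using simple unfolding finite_simple_graph_def by blast

lemma edge_subset: "e \<in> edges G \<Longrightarrow> e \<subseteq> vertices G"
  using simple unfolding finite_simple_graph_def by blast

lemma edge_cases:
  assumes "e \<in> edges G"
  obtains u v where "e = {u, v}" "u \<noteq> v" "u \<in> vertices G" "v \<in> vertices G"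
  using assms simple edge_in_vertices[OF simple] unfolding finite_simple_graph_def
  by (metis card_2_iff)

lemma inj_on_p: "inj_on p (vertices G)"
  using drawing unfolding plane_drawing_def by blast

lemma arc_between_edge:
  assumes "{u, v} \<in> edges G"
  shows "arc_between (edge_arc {u, v}) (p u) (p v)"
proof -
  have "arc (\<gamma> {u, v})" "{pathstart (\<gamma> {u, v}), pathfinish (\<gamma> {u, v})} = {p u, p v}"
    using drawing assms unfolding plane_drawing_def by auto
  then have "arc_between (edge_arc {u, v}) (p u) (p v) \<or> arc_between (edge_arc {u, v}) (p v) (p u)"
    unfolding arc_between_def edge_arc_def doubleton_eq_iff by blast
  then show ?thesis using arc_between_sym by blast
qed

lemma ends_in_edge_arc: "e \<in> edges G \<Longrightarrow> p ` e \<subseteq> edge_arc e"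
  by (metis arc_between_edge arc_between_ends(1,2) edge_cases empty_subsetI image_empty image_insert insert_subset)

lemma edge_arc_vertices: "e \<in> edges G \<Longrightarrow> edge_arc e \<inter> p ` vertices G = p ` e"
  using drawing edge_subset[of e] ends_in_edge_arc[of e] unfolding plane_drawing_def edge_arc_def by blast

lemma edge_arcs_meet:
  assumes "e \<in> edges G" "e' \<in> edges G" "e \<noteq> e'"
  shows "edge_arc e \<inter> edge_arc e' = p ` (e \<inter> e')"
proof -
  have "(edge_arc e - p ` e) \<inter> edge_arc e' = {}" "(edge_arc e' - p ` e') \<inter> edge_arc e = {}"
    using drawing assms unfolding plane_drawing_def edge_arc_def by blast+
  moreover have "p ` (e \<inter> e') = p ` e \<inter> p ` e'"
    using inj_on_image_Int[OF inj_on_p] edge_subset assms by blast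
  ultimately show ?thesis using ends_in_edge_arc assms by blast
qed

lemma compact_drawn: "V \<subseteq> vertices G \<Longrightarrow> E \<subseteq> edges G \<Longrightarrow> compact (drawn V E)"
proof -
  assume VE: "V \<subseteq> vertices G" "E \<subseteq> edges G"
  have "finite (p ` V)" "finite E"
    using VE finite_vertices finite_edges[OF simple] finite_subset by blast+
  moreover have "compact (edge_arc e)" if "e \<in> E" for e
    using that VE edge_cases[of e] arc_between_topology(1)[OF arc_between_edge] by (metis subset_iff)
  ultimately show ?thesis
    unfolding drawn_def by (metis compact_UN compact_Un finite_imp_compact)
qed

lemma edge_arc_Int_drawn:
  assumes "e \<in> edges G" "V \<subseteq> vertices G" "E \<subseteq> edges G" "e \<notin> E" "\<And>f. f \<in> E \<Longrightarrow> f \<subseteq> V"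
  shows "drawn V E \<inter> edge_arc e = p ` (e \<inter> V)"
proof -
  have "p ` V \<inter> edge_arc e = p ` (e \<inter> V)"
  proof -
    have "p ` V \<inter> edge_arc e = p ` V \<inter> p ` e" using edge_arc_vertices[OF assms(1)] assms(2) by blast
    also have "\<dots> = p ` (e \<inter> V)"
      using inj_on_image_Int[OF inj_on_p edge_subset[OF assms(1)] assms(2)] by blast
    finally show ?thesis .
  qed
  moreover have "edge_arc f \<inter> edge_arc e \<subseteq> p ` (e \<inter> V)" if "f \<in> E" for f
  proof -
    have "edge_arc f \<inter> edge_arc e = p ` (f \<inter> e)"
      using edge_arcs_meet[of f e] assms that by blast
    then show ?thesis using assms(5)[OF that] by blast
  qed
  ultimately show ?thesis unfolding drawn_def by blast
qed

lemma path_connected_drawn: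
  assumes "V \<subseteq> vertices G" "E \<subseteq> edges G" "\<And>e. e \<in> E \<Longrightarrow> e \<subseteq> V" and con: "connected_graph (V, E)"
  shows "path_connected (drawn V E)"
proof -
  let ?K = "drawn V E"
  have edge: "path_component ?K z z'" if "e \<in> E" "z \<in> edge_arc e" "z' \<in> edge_arc e" for e z z'
  proof -
    have "path_connected (edge_arc e)"
      using that assms edge_cases[of e] arc_between_topology(4)[OF arc_between_edge] by (metis subset_iff)
    then have "path_component (edge_arc e) z z'" using that path_connected_component by blast
    then show ?thesis
      using path_component_of_subset[of "edge_arc e" ?K] that unfolding drawn_def by blast
  qed
  have vert: "path_component ?K (p u) (p v)" if "u \<in> V" "v \<in> V" for u v
  proof -
    have "(u, v) \<in> (adjacency (V, E))\<^sup>*" using con that unfolding connected_graph_def by simp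
    then show ?thesis
    proof (induction rule: rtrancl_induct)
      case base
      then show ?case using that by (simp add: drawn_def path_component_refl)
    next
      case (step y z)
      then have "{y, z} \<in> E" unfolding adjacency_def by simp
      then have "path_component ?K (p y) (p z)"
        using edge[of "{y, z}"] ends_in_edge_arc[of "{y, z}"] assms(2) by blast
      then show ?case using step.IH path_component_trans by blast
    qed
  qed
  have base: "\<exists>u\<in>V. path_component ?K z (p u)" if z: "z \<in> ?K" for z
  proof -
    consider u where "u \<in> V" "z = p u" | e where "e \<in> E" "z \<in> edge_arc e"
      using z unfolding drawn_def by blast
    then show ?thesis
    proof cases
      case 1
      then show ?thesis using path_component_refl[OF z] by auto
    next
      case 2
      then have e: "e \<in> edges G" using assms(2) by blast
      obtain u v where uv: "e = {u, v}" by (rule edge_cases[OF e])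
      then have "path_component ?K z (p u)"
        using edge[OF 2] ends_in_edge_arc[OF e] by blast
      then show ?thesis using assms(3)[OF 2(1)] uv by blast
    qed
  qed
  show ?thesis
    unfolding path_connected_component
  proof (intro ballI)
    fix y z assume "y \<in> ?K" "z \<in> ?K"
    then obtain u v where "u \<in> V" "path_component ?K y (p u)" "v \<in> V" "path_component ?K z (p v)"
      using base by blast
    then show "path_component ?K y z"
      using vert[of u v] by (meson path_component_sym path_component_trans)
  qed
qed

text \<open>This carries vertex connectivity over to the plane. A walk in the graph without
  \<open>X\<close> traces a connected set, and its edges share no endpoint with edges inside
  \<open>X\<close>, so their arcs are disjoint.\<close>

lemma connected_component_avoiding:
  assumes st: "(s, t) \<in> (adjacency (induced_subgraph G (vertices G - X)))\<^sup>*" "s \<in> vertices G - X"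
    and E: "E \<subseteq> edges G" "\<And>e. e \<in> E \<Longrightarrow> e \<subseteq> X"
  shows "connected_component (- (\<Union>e\<in>E. edge_arc e)) (p s) (p t)"
  using st(1)
proof (induction rule: rtrancl_induct)
  case base
  have "p s \<notin> edge_arc e" if "e \<in> E" for e
  proof
    assume "p s \<in> edge_arc e"
    then have "p s \<in> p ` e" using edge_arc_vertices[of e] that E st by blast
    then have "s \<in> e" using inj_on_p edge_subset[of e] that E st by (metis DiffD1 inj_on_image_mem_iff subset_iff)
    then show False using that E st by blast
  qed
  then show ?case by auto
next
  case (step y z)
  then have yz: "{y, z} \<in> edges G" "y \<notin> X" "z \<notin> X" unfolding adjacency_induced_subgraph by auto
  have "edge_arc {y, z} \<inter> edge_arc e = {}" if "e \<in> E" for e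
    using edge_arcs_meet[of "{y, z}" e] yz that E by blast
  then have "connected_component (- (\<Union>e\<in>E. edge_arc e)) (p y) (p z)"
    unfolding connected_component_def
    using arc_between_topology(3)[OF arc_between_edge[OF yz(1)]] ends_in_edge_arc[OF yz(1)]
    by (intro exI[of _ "edge_arc {y, z}"]) auto
  then show ?case using step.IH connected_component_trans by metis
qed

text \<open>Three of the paths through common neighbours form a theta curve, and the fourth
  neighbour serves as the point \<open>x\<close> of \<open>theta_separates\<close>. Some two paths
  then separate the remaining two neighbours, although removing the vertices of those two paths
  leaves a connected graph.\<close>

lemma common_neighbours_5_connected:
  assumes con: "k_connected 5 G" and uv: "u \<noteq> v"
    and W: "\<And>w. w \<in> W \<Longrightarrow> {u, w} \<in> edges G \<and> {w, v} \<in> edges G"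
  shows "card W < 4"
proof (rule ccontr)
  assume "\<not> card W < 4"
  then obtain W' where W': "W' \<subseteq> W" "card W' = 4" by (metis not_less obtain_subset_with_card_n)
  obtain w1 W3 where W3: "W' = insert w1 W3" "w1 \<notin> W3" "card W3 = 3"
    using W'(2) card_eq_SucD[of W' 3] by auto
  obtain w2 w3 w4 where w: "W3 = {w2, w3, w4}" "w2 \<noteq> w3" "w2 \<noteq> w4" "w3 \<noteq> w4"
    using W3(3) unfolding card_3_iff by blast
  let ?A = "\<lambda>w. edge_arc {u, w} \<union> edge_arc {w, v}"
  have ne: "w \<noteq> u" "w \<noteq> v" "w \<in> vertices G" if "w \<in> W'" for w
    using W[of w] that W'(1) edge_in_vertices[OF simple] by blast+
  have uvV: "u \<in> vertices G" "v \<in> vertices G" using W[of w1] W'(1) W3(1) edge_in_vertices[OF simple] by blast+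
  have arcA: "arc_between (?A w) (p u) (p v)" if "w \<in> W'" for w
  proof (rule arc_between_join)
    show "arc_between (edge_arc {u, w}) (p u) (p w)" "arc_between (edge_arc {w, v}) (p w) (p v)"
      using W W' that arc_between_edge by blast+
    have "{u, w} \<noteq> {w, v}" "{u, w} \<inter> {w, v} = {w}" using uv ne[OF that] by auto
    then show "edge_arc {u, w} \<inter> edge_arc {w, v} = {p w}"
      using edge_arcs_meet[of "{u, w}" "{w, v}"] W[of w] W' that by auto
  qed
  have meet: "?A w \<inter> ?A w' = {p u, p v}" if ww: "w \<in> W'" "w' \<in> W'" "w \<noteq> w'" for w w'
  proof -
    have E: "{u, w} \<in> edges G" "{u, w'} \<in> edges G" "{w, v} \<in> edges G" "{w', v} \<in> edges G"
      using W W' ww by blast+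
    have "edge_arc {u, w} \<inter> edge_arc {u, w'} = p ` ({u, w} \<inter> {u, w'})"
      "edge_arc {u, w} \<inter> edge_arc {w', v} = p ` ({u, w} \<inter> {w', v})"
      "edge_arc {w, v} \<inter> edge_arc {u, w'} = p ` ({w, v} \<inter> {u, w'})"
      "edge_arc {w, v} \<inter> edge_arc {w', v} = p ` ({w, v} \<inter> {w', v})"
      using ww uv ne[OF ww(1)] ne[OF ww(2)] by (intro edge_arcs_meet E; auto simp: doubleton_eq_iff)+
    moreover have "{u, w} \<inter> {u, w'} = {u}" "{u, w} \<inter> {w', v} = {}" "{w, v} \<inter> {u, w'} = {}"
      "{w, v} \<inter> {w', v} = {v}"
      using ww uv ne[OF ww(1)] ne[OF ww(2)] by auto
    ultimately show ?thesis by (simp add: Int_Un_distrib Int_Un_distrib2 insert_commute)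
  qed
  have q: "p w \<in> ?A w - {p u, p v}" if "w \<in> W'" for w
  proof -
    have "p w \<noteq> p u" "p w \<noteq> p v" using inj_on_p ne[OF that] uvV by (metis inj_onD)+
    moreover have "p w \<in> edge_arc {u, w}" using ends_in_edge_arc[of "{u, w}"] W W' that by blast
    ultimately show ?thesis by blast
  qed
  have off: "p w \<notin> ?A w'" if "w \<in> W'" "w' \<in> W'" "w \<noteq> w'" for w w'
    using q[OF that(1)] meet[OF that] by blast
  have cc: "connected_component (- (?A w \<union> ?A w')) (p s) (p t)"
    if "w \<in> W'" "w' \<in> W'" "s \<in> W'" "t \<in> W'" "s \<notin> {w, w'}" "t \<notin> {w, w'}" for w w' s t
  proof -
    let ?X = "{u, v, w, w'}"
    \<comment> \<open>Only an upper bound is available, since \<open>w\<close> and \<open>w'\<close>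
      may coincide here. Staying below 5 is what connectivity requires.\<close>
    have "card ?X \<le> 4" by (simp add: card_insert_if)
    then have "connected_graph (induced_subgraph G (vertices G - ?X))"
      using con ne that uvV unfolding k_connected_def by simp
    then have st: "(s, t) \<in> (adjacency (induced_subgraph G (vertices G - ?X)))\<^sup>*"
      using that ne unfolding connected_graph_def induced_subgraph_def by simp
    have "connected_component (- (\<Union>e\<in>{{u, w}, {w, v}, {u, w'}, {w', v}}. edge_arc e)) (p s) (p t)"
      by (rule connected_component_avoiding[OF st]) (use that ne W W' in auto)
    then show ?thesis by (simp add: Un_assoc Int_assoc)
  qed
  have "w1 \<in> W'" "w2 \<in> W'" "w3 \<in> W'" "w4 \<in> W'" "w1 \<notin> {w2, w3, w4}" using W3 w by auto
  note in_W' = this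
  have "p w1 \<notin> ?A w2 \<union> ?A w3 \<union> ?A w4" using off[of w1] in_W' by blast
  with theta_separates[OF arcA[OF in_W'(2)] arcA[OF in_W'(3)] arcA[OF in_W'(4)]
      meet[OF in_W'(2,3) w(2)] meet[OF in_W'(2,4) w(3)] meet[OF in_W'(3,4) w(4)]
      q[OF in_W'(2)] q[OF in_W'(3)] q[OF in_W'(4)]]
  have "\<not> connected_component (- (?A w2 \<union> ?A w3)) (p w1) (p w4) \<or>
    \<not> connected_component (- (?A w2 \<union> ?A w4)) (p w1) (p w3) \<or>
    \<not> connected_component (- (?A w3 \<union> ?A w4)) (p w1) (p w2)" .
  moreover have "connected_component (- (?A w2 \<union> ?A w3)) (p w1) (p w4)"
    "connected_component (- (?A w2 \<union> ?A w4)) (p w1) (p w3)"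
    "connected_component (- (?A w3 \<union> ?A w4)) (p w1) (p w2)"
    using in_W' w by (intro cc; simp)+
  ultimately show False by blast
qed

section \<open>Euler's inequality and the edge bound\<close>

text \<open>This is one direction of Euler's formula for a connected subgraph, arranged to avoid
  subtraction on the naturals. The points of \<open>X\<close> witness a lower bound for the number
  of faces.\<close>

definition many_faces :: "'a set \<Rightarrow> 'a set set \<Rightarrow> bool" where
  "many_faces V E \<longleftrightarrow> V \<noteq> {} \<and> V \<subseteq> vertices G \<and> E \<subseteq> edges G \<and> (\<forall>e\<in>E. e \<subseteq> V) \<and>
     path_connected (drawn V E) \<and>
     (\<exists>X. in_distinct_faces (drawn V E) X \<and> card E + 2 \<le> card X + card V)"

text \<open>A missing edge between vertices of \<open>V\<close> is a chord, and pays for itself with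
  an additional face. If there is none, an edge leaving \<open>V\<close> brings a new vertex, and
  the representatives need only be moved off it.\<close>

lemma many_faces_extend:
  assumes con: "connected_graph G" and good: "many_faces V E" and neq: "V \<noteq> vertices G \<or> E \<noteq> edges G"
  shows "\<exists>V' E'. many_faces V' E' \<and> card V + card E < card V' + card E'"
proof -
  let ?K = "drawn V E"
  obtain X where X: "in_distinct_faces ?K X" "card E + 2 \<le> card X + card V"
    and VE: "V \<noteq> {}" "V \<subseteq> vertices G" "E \<subseteq> edges G" "\<And>e. e \<in> E \<Longrightarrow> e \<subseteq> V" "path_connected ?K"
    using good unfolding many_faces_def by blast
  have fin: "finite V" "finite E"
    using VE finite_vertices finite_edges[OF simple] finite_subset by blast+
  have clo: "closed ?K" using compact_drawn VE compact_imp_closed by blast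
  show ?thesis
  proof (cases "\<exists>e\<in>edges G - E. e \<subseteq> V")
    case True
    then obtain e where e: "e \<in> edges G" "e \<notin> E" "e \<subseteq> V" by blast
    obtain u v where uv: "e = {u, v}" by (rule edge_cases[OF e(1)])
    have arc: "arc_between (edge_arc e) (p u) (p v)" using arc_between_edge e uv by blast
    have meet: "?K \<inter> edge_arc e = {p u, p v}"
      using edge_arc_Int_drawn[OF e(1) VE(2,3) e(2)] VE(4) uv e(3) by auto
    obtain Y where Y: "in_distinct_faces (?K \<union> edge_arc e) Y" "card X < card Y"
      using in_distinct_faces_add_chord[OF clo VE(5) arc meet X(1)] by blast
    have ext: "drawn V (insert e E) = ?K \<union> edge_arc e" unfolding drawn_def by auto
    have "path_connected (?K \<union> edge_arc e)"
      using VE(5) arc_between_topology(4)[OF arc] meet by (intro path_connected_Un) auto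
    then have "many_faces V (insert e E)"
      unfolding many_faces_def ext using VE e Y X(2) fin by (auto intro!: exI[of _ Y])
    then show ?thesis using e fin by (intro exI[of _ V] exI[of _ "insert e E"]) auto
  next
    case False
    have "V \<noteq> vertices G" using False neq VE(3) edge_subset by blast
    then obtain t where t: "t \<in> vertices G" "t \<notin> V" using VE by blast
    obtain s where "s \<in> V" using VE by blast
    then obtain u v where uv: "u \<in> V" "v \<notin> V" "{u, v} \<in> edges G"
      by (rule connected_graph_edge_leaving[OF con _ VE(2) t])
    let ?e = "{u, v}"
    have e: "?e \<notin> E" "v \<in> vertices G" using uv VE(4) edge_subset by blast+
    have arc: "arc_between (edge_arc ?e) (p u) (p v)" using arc_between_edge uv by blast
    obtain f where f: "in_distinct_faces (?K \<union> edge_arc ?e) (f ` X)" "inj_on f X"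
      using in_distinct_faces_perturb[OF clo arc X(1)] by blast
    have ext: "drawn (insert v V) (insert ?e E) = ?K \<union> edge_arc ?e"
      unfolding drawn_def using ends_in_edge_arc[OF uv(3)] by auto
    have "p u \<in> ?K \<inter> edge_arc ?e" using uv ends_in_edge_arc[OF uv(3)] unfolding drawn_def by blast
    then have "path_connected (?K \<union> edge_arc ?e)"
      using VE(5) arc_between_topology(4)[OF arc] by (intro path_connected_Un) auto
    moreover have "card (insert ?e E) + 2 \<le> card (f ` X) + card (insert v V)"
      using X(2) uv e fin by (simp add: card_image[OF f(2)])
    ultimately have "many_faces (insert v V) (insert ?e E)"
      unfolding many_faces_def ext using VE uv e f(1) by blast
    moreover have "card V + card E < card (insert v V) + card (insert ?e E)" using uv e fin by simp
    ultimately show ?thesis by blast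
  qed
qed

text \<open>A single vertex with one point off it satisfies the inequality. Among the subgraphs
  satisfying it, one with the most vertices and edges together cannot be extended, so it is all of
  \<open>G\<close>.\<close>

lemma many_faces_all:
  assumes con: "connected_graph G"
  shows "many_faces (vertices G) (edges G)"
proof -
  obtain v where v: "v \<in> vertices G" using con unfolding connected_graph_def by blast
  obtain x where x: "x \<noteq> p v" by (metis add_cancel_left_right one_neq_zero)
  have "in_distinct_faces (drawn {v} {}) {x}"
    using x unfolding in_distinct_faces_def drawn_def by auto
  then have base: "many_faces {v} {}"
    unfolding many_faces_def using v by (auto intro!: exI[of _ "{x}"] simp: drawn_def)
  have bound: "card V + card E < Suc (card (vertices G) + card (edges G))" if "many_faces V E" for V E
    using that finite_vertices finite_edges[OF simple] unfolding many_faces_def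
    by (simp add: add_mono card_mono less_Suc_eq_le)
  define P where "P = (\<lambda>(V, E). many_faces V E)"
  define m where "m = (\<lambda>(V :: 'a set, E :: 'a set set). card V + card E)"
  have "\<exists>z. P z \<and> (\<forall>y. P y \<longrightarrow> m y \<le> m z)"
    by (rule ex_has_greatest_nat[of P "({v}, {})" m "Suc (card (vertices G) + card (edges G))"])
      (use base bound in \<open>auto simp: P_def m_def\<close>)
  then obtain V E where VE: "many_faces V E" and
    max: "\<And>V' E'. many_faces V' E' \<Longrightarrow> card V' + card E' \<le> card V + card E"
    unfolding P_def m_def by auto
  then show ?thesis using many_faces_extend[OF con VE] by (metis not_less)
qed

text \<open>If the closure of a face met the interiors of at most two edges, its frontier would lie
  in two edge arcs and the vertices. By \<open>face_boundary_not_two_arcs\<close> so would the whole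
  drawing, leaving no room for the interior of a third edge.\<close>

lemma face_touches_three_edges:
  assumes "x \<notin> drawn (vertices G) (edges G)" "3 \<le> card (edges G)"
  shows "3 \<le> card {e \<in> edges G.
    closure (connected_component_set (- drawn (vertices G) (edges G)) x) \<inter> (edge_arc e - p ` e) \<noteq> {}}"
    (is "3 \<le> card ?T")
proof (rule ccontr)
  let ?K = "drawn (vertices G) (edges G)"
  let ?F = "connected_component_set (- ?K) x"
  have finE: "finite (edges G)" using finite_edges[OF simple] .
  assume "\<not> 3 \<le> card ?T"
  \<comment> \<open>The touched edges are padded to exactly two, so that two arcs are available even
    if fewer edges are touched.\<close>
  then have "\<exists>T'. ?T \<subseteq> T' \<and> T' \<subseteq> edges G \<and> card T' = 2"
    using assms(2) finE by (intro exists_subset_between) auto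
  then obtain T' where T': "?T \<subseteq> T'" "T' \<subseteq> edges G" "card T' = 2" by blast
  then obtain e1 e2 where e: "T' = {e1, e2}" "e1 \<noteq> e2" "e1 \<in> edges G" "e2 \<in> edges G"
    unfolding card_2_iff by blast
  have "\<not> edges G \<subseteq> T'" using assms(2) T'(3) card_mono[of T' "edges G"] e(1) by auto
  then obtain e3 where e3: "e3 \<in> edges G" "e3 \<noteq> e1" "e3 \<noteq> e2" using e by blast
  have K: "closed ?K" using compact_drawn compact_imp_closed by blast
  obtain a b where ab: "e1 = {a, b}" by (rule edge_cases[OF e(3)])
  obtain c d where cd: "e2 = {c, d}" by (rule edge_cases[OF e(4)])
  have "connected (edge_arc e1 \<inter> edge_arc e2)"
  proof -
    \<comment> \<open>Distinct edges share at most one endpoint, so their arcs meet in at most one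
      point.\<close>
    obtain s where "e1 \<inter> e2 \<subseteq> {s}" using ab cd e(2) by fastforce
    then show ?thesis
      using edge_arcs_meet[OF e(3,4,2)] by (metis connected_empty connected_sing image_empty image_insert subset_singletonD)
  qed
  moreover have "frontier ?F \<subseteq> p ` vertices G \<union> (edge_arc e1 \<union> edge_arc e2)"
  proof
    fix z assume z: "z \<in> frontier ?F"
    have "frontier ?F \<subseteq> ?K"
      using frontier_of_connected_component_subset[of "- ?K" x] frontier_subset_closed[OF K] by simp
    then consider "z \<in> p ` vertices G" | e where "e \<in> edges G" "z \<in> edge_arc e"
      using z unfolding drawn_def by blast
    then show "z \<in> p ` vertices G \<union> (edge_arc e1 \<union> edge_arc e2)"
    proof cases
      case 1 then show ?thesis by blast
    next
      case 2
      show ?thesis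
      proof (cases "e \<in> ?T")
        case True then show ?thesis using T'(1) e(1) 2 by blast
      next
        case False
        then have "z \<in> p ` e" using z 2 unfolding frontier_def by blast
        then show ?thesis using edge_subset[OF 2(1)] by blast
      qed
    qed
  qed
  ultimately have "?K \<subseteq> p ` vertices G \<union> (edge_arc e1 \<union> edge_arc e2)"
    using face_boundary_not_two_arcs[OF K assms(1) finite_imageI[OF finite_vertices] _
        arc_between_edge[of a b, folded ab, OF e(3)] _ arc_between_edge[of c d, folded cd, OF e(4)], of p]
      e(3,4) unfolding drawn_def by blast
  then have sub: "edge_arc e3 \<subseteq> p ` vertices G \<union> (edge_arc e1 \<union> edge_arc e2)"
    using e3 unfolding drawn_def by blast
  obtain s t where st: "e3 = {s, t}" by (rule edge_cases[OF e3(1)])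
  have "edge_arc e3 - p ` e3 \<noteq> {}"
    using arc_between_topology(7)[OF arc_between_edge[of s t]] e3(1) st by simp
  moreover have "edge_arc e3 \<inter> (p ` vertices G \<union> (edge_arc e1 \<union> edge_arc e2)) \<subseteq> p ` e3"
    unfolding Int_Un_distrib edge_arc_vertices[OF e3(1)] edge_arcs_meet[OF e3(1) e(3) e3(2)]
      edge_arcs_meet[OF e3(1) e(4) e3(3)] by auto
  ultimately show False using sub by blast
qed

text \<open>Pairs of a representative and an edge touched by its face are counted twice: at least
  three for each point, at most two for each edge. Combining this with Euler's inequality gives the
  bound. The absence of bridges keeps the drawing without \<open>e\<close> path connected, which
  makes \<open>e\<close> a chord of it.\<close>

lemma card_edges_planar:
  assumes con: "connected_graph G" "\<And>e. e \<in> edges G \<Longrightarrow> connected_graph (vertices G, edges G - {e})"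
    and "3 \<le> card (edges G)"
  shows "card (edges G) + 6 \<le> 3 * card (vertices G)"
proof -
  let ?K = "drawn (vertices G) (edges G)"
  define R where "R x e \<longleftrightarrow> closure (connected_component_set (- ?K) x) \<inter> (edge_arc e - p ` e) \<noteq> {}" for x e
  have finE: "finite (edges G)" using finite_edges[OF simple] .
  obtain X where X: "in_distinct_faces ?K X" "card (edges G) + 2 \<le> card X + card (vertices G)"
    using many_faces_all[OF con(1)] unfolding many_faces_def by blast
  have finX: "finite X" and XK: "X \<inter> ?K = {}" using X(1) unfolding in_distinct_faces_def by blast+
  have "card X * 3 \<le> (\<Sum>x\<in>X. card {e \<in> edges G. R x e})"
    using face_touches_three_edges[OF _ assms(3)] XK unfolding R_def
    by (intro sum_bounded_below[of X "3::nat", simplified]) blast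
  also have "\<dots> = (\<Sum>e\<in>edges G. card {x \<in> X. R x e})"
    by (rule sum_multicount_gen[OF finX finE]) simp
  also have "\<dots> \<le> card (edges G) * 2"
  proof (rule sum_bounded_above[of "edges G" _ "2::nat", simplified])
    fix e assume e: "e \<in> edges G"
    obtain u v where uv: "e = {u, v}" by (rule edge_cases[OF e])
    let ?K' = "drawn (vertices G) (edges G - {e})"
    have eq: "?K' \<union> edge_arc e = ?K" using e unfolding drawn_def by blast
    show "card {x \<in> X. R x e} \<le> 2"
    proof (rule chord_meets_two_faces)
      show "closed ?K'" using compact_drawn[of "vertices G" "edges G - {e}"] compact_imp_closed by blast
      show "path_connected ?K'" using con(2)[OF e] edge_subset by (intro path_connected_drawn) auto
      show "arc_between (edge_arc e) (p u) (p v)" using e uv arc_between_edge by blast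
      have "?K' \<inter> edge_arc e = p ` (e \<inter> vertices G)"
        using edge_subset by (intro edge_arc_Int_drawn e) auto
      then show "?K' \<inter> edge_arc e = {p u, p v}" using edge_subset[OF e] uv by auto
      show "in_distinct_faces (?K' \<union> edge_arc e) {x \<in> X. R x e}"
        using X(1) unfolding eq in_distinct_faces_def by (auto intro: pairwise_subset)
    qed (use eq uv in \<open>auto simp: R_def\<close>)
  qed
  finally show ?thesis using X(2) by linarith
qed

end

lemma not_6_connected_planar:
  assumes G: "finite_simple_graph G" "connected_graph G" "planar G"
  shows "\<not> k_connected 6 G"
proof
  assume con: "k_connected 6 G"
  obtain p \<gamma> where "plane_drawing G p \<gamma>" using G(3) unfolding planar_def by blast
  then interpret plane_graph G p \<gamma> using G(1) by unfold_locales
  have finE: "finite (edges G)" using finite_edges[OF simple] .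
  have inc: "6 \<le> card {e \<in> edges G. v \<in> e}" if v: "v \<in> vertices G" for v
  proof -
    have "inj_on (\<lambda>w. {v, w}) {w. {v, w} \<in> edges G}"
      by (auto simp: inj_on_def doubleton_eq_iff)
    then have "card {w. {v, w} \<in> edges G} \<le> card {e \<in> edges G. v \<in> e}"
      using finE by (intro card_inj_on_le) auto
    then show ?thesis using k_connected_degree[OF G(1) con v] by linarith
  qed
  \<comment> \<open>Handshake count of incidences: at least 6 at each vertex, exactly 2 at each
    edge.\<close>
  have "card (vertices G) * 6 \<le> (\<Sum>v\<in>vertices G. card {e \<in> edges G. v \<in> e})"
    using inc by (intro sum_bounded_below[of _ "6::nat", simplified])
  also have "\<dots> = (\<Sum>e\<in>edges G. card {v \<in> vertices G. v \<in> e})"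
    by (rule sum_multicount_gen[OF finite_vertices finE]) simp
  also have "\<dots> = (\<Sum>e\<in>edges G. 2)"
  proof (rule sum.cong)
    fix e assume "e \<in> edges G"
    then have "{v \<in> vertices G. v \<in> e} = e" "card e = 2"
      using simple unfolding finite_simple_graph_def by blast+
    then show "card {v \<in> vertices G. v \<in> e} = 2" by simp
  qed simp
  finally have deg: "card (vertices G) * 6 \<le> card (edges G) * 2" by simp
  have "6 < card (vertices G)" using con unfolding k_connected_def by blast
  moreover have "card (edges G) + 6 \<le> 3 * card (vertices G)"
  proof (rule card_edges_planar[OF G(2)])
    show "connected_graph (vertices G, edges G - {e})" if "e \<in> edges G" for e
      using connected_graph_delete_edge[OF G(1) _ that] k_connected_mono[OF con] by simp
    show "3 \<le> card (edges G)" using deg \<open>6 < card (vertices G)\<close> by linarith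
  qed
  ultimately show False using deg by linarith
qed

subsection \<open>Connected triples\<close>

lemma T3_subset_of_adjacent:
  assumes "finite_simple_graph G" "{u, v} \<in> edges G" "{u, w} \<in> edges G" "v \<noteq> w"
  shows "{u, v, w} \<in> T3 G"
proof -
  let ?A = "adjacency (induced_subgraph G {u, v, w})"
  have uvw: "u \<in> vertices G" "v \<in> vertices G" "w \<in> vertices G" "u \<noteq> v" "u \<noteq> w"
    using assms edge_in_vertices[OF assms(1)] by blast+
  have "(u, v) \<in> ?A" "(u, w) \<in> ?A" "(v, u) \<in> ?A" "(w, u) \<in> ?A"
    using assms unfolding adjacency_induced_subgraph by (auto simp: insert_commute)
  then have "(x, u) \<in> ?A\<^sup>*" "(u, x) \<in> ?A\<^sup>*" if "x \<in> {u, v, w}" for x using that by auto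
  then have "(x, y) \<in> ?A\<^sup>*" if "x \<in> {u, v, w}" "y \<in> {u, v, w}" for x y
    using that rtrancl_trans by metis
  then have "connected_graph (induced_subgraph G {u, v, w})"
    unfolding connected_graph_def by (simp add: induced_subgraph_def)
  then show ?thesis using uvw assms(4) unfolding T3_def by simp
qed

text \<open>Within a connected triple \<open>u\<close> has a neighbour; once \<open>v\<close> is
  excluded, only the third vertex is left.\<close>

lemma T3_nonadjacent:
  assumes "finite_simple_graph G" "{u, v, w} \<in> T3 G" "u \<noteq> v" "{u, v} \<notin> edges G"
  shows "{u, w} \<in> edges G"
proof -
  let ?H = "induced_subgraph G {u, v, w}"
  have con: "connected_graph ?H" using assms(2) unfolding T3_def by blast
  obtain s t where "s \<in> {u}" "t \<notin> {u}" "{s, t} \<in> edges ?H"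
    by (rule connected_graph_edge_leaving[OF con, of u "{u}" v])
      (use assms(3) in \<open>auto simp: induced_subgraph_def\<close>)
  then show ?thesis using assms(4) unfolding induced_subgraph_def by auto
qed

lemma T3_5_connected_edges_subset:
  assumes G: "G \<in> k_connected_planar_graphs 5" and H: "H \<in> k_connected_planar_graphs 5"
    and T: "T3 G = T3 H"
  shows "edges G \<subseteq> edges H"
proof
  fix e assume e: "e \<in> edges G"
  have G': "finite_simple_graph G" "k_connected 5 G" and H': "finite_simple_graph H" "k_connected 5 H"
    using G H unfolding k_connected_planar_graphs_def by auto
  obtain p \<gamma> where "plane_drawing H p \<gamma>" using H unfolding k_connected_planar_graphs_def planar_def by blast
  then interpret H: plane_graph H p \<gamma> using H'(1) by unfold_locales
  have "card e = 2" using G'(1) e unfolding finite_simple_graph_def by blast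
  then obtain u v where uv: "e = {u, v}" "u \<noteq> v" by (meson card_2_iff)
  have u: "u \<in> vertices G" using edge_in_vertices[OF G'(1)] e uv by blast
  show "e \<in> edges H"
  proof (rule ccontr)
    assume n: "e \<notin> edges H"
    let ?N = "{w. {u, w} \<in> edges G}"
    have "{u, w} \<in> edges H \<and> {w, v} \<in> edges H" if "w \<in> ?N - {v}" for w
    proof -
      have *: "{u, v, w} \<in> T3 H"
        using T3_subset_of_adjacent[OF G'(1)] e uv that T by blast
      \<comment> \<open>The non-edge is read in both orders, once for a neighbour of
        \<open>v\<close> and once for a neighbour of \<open>u\<close>.\<close>
      then have "{v, u, w} \<in> T3 H" by (simp add: insert_commute)
      then have "{v, w} \<in> edges H"
        using T3_nonadjacent[OF H'(1), of v u w] uv n by (simp add: insert_commute)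
      then show ?thesis using T3_nonadjacent[OF H'(1) *] uv n by (simp add: insert_commute)
    qed
    then have "card (?N - {v}) < 4" by (rule H.common_neighbours_5_connected[OF H'(2) uv(2)])
    moreover have "5 \<le> card ?N" by (rule k_connected_degree[OF G' u])
    moreover have "card ?N - 1 \<le> card (?N - {v})" by (simp add: card_Diff_singleton_if)
    ultimately show False by linarith
  qed
qed

text \<open>Each vertex has two neighbours and hence lies in a connected triple. This recovers the
  vertex set, which equality of labeled graphs requires besides the edges.\<close>

lemma k_connected_vertices_T3:
  assumes "finite_simple_graph G" "k_connected 2 G"
  shows "vertices G = \<Union> (T3 G)"
proof
  show "vertices G \<subseteq> \<Union> (T3 G)"
  proof
    fix v assume v: "v \<in> vertices G"
    obtain N where "N \<subseteq> {w. {v, w} \<in> edges G}" "card N = 2"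
      using k_connected_degree[OF assms v] by (metis obtain_subset_with_card_n)
    then obtain x y where "x \<noteq> y" "{v, x} \<in> edges G" "{v, y} \<in> edges G" by (auto simp: card_2_iff)
    then show "v \<in> \<Union> (T3 G)" using T3_subset_of_adjacent[OF assms(1)] by blast
  qed
  show "\<Union> (T3 G) \<subseteq> vertices G" unfolding T3_def by blast
qed

lemma T3_reconstructible_5_connected_planar: "T3_reconstructible (k_connected_planar_graphs 5)"
proof -
  have "G = H" if G: "G \<in> k_connected_planar_graphs 5" and H: "H \<in> k_connected_planar_graphs 5"
    and T: "T3 G = T3 H" for G H :: "'a graph"
  proof (rule prod_eqI)
    show "edges G = edges H" using T3_5_connected_edges_subset G H T by (metis subset_antisym)
    have "vertices K = \<Union> (T3 K)" if "K \<in> k_connected_planar_graphs 5" for K :: "'a graph"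
      using that k_connected_mono[of 5 K 2] unfolding k_connected_planar_graphs_def
      by (intro k_connected_vertices_T3) auto
    then show "vertices G = vertices H" using G H T by metis
  qed
  then show ?thesis unfolding T3_reconstructible_def by blast
qed

subsection \<open>The octahedron\<close>

lemma less_6_cases: "k < (6::nat) \<Longrightarrow> k = 0 \<or> k = 1 \<or> k = 2 \<or> k = 3 \<or> k = 4 \<or> k = 5"
  by linarith

text \<open>Antipodal vertices have congruent indices modulo 3.\<close>

definition octahedron :: "(nat \<Rightarrow> 'a) \<Rightarrow> 'a graph" where
  "octahedron g = (g ` {..<6}, {{g i, g j} | i j. i < 6 \<and> j < 6 \<and> i mod 3 \<noteq> j mod 3})"

lemma octahedron_edge_iff:
  assumes "inj_on g {..<6}" "i < 6" "j < 6"
  shows "{g i, g j} \<in> edges (octahedron g) \<longleftrightarrow> i mod 3 \<noteq> j mod 3"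
proof
  assume "{g i, g j} \<in> edges (octahedron g)"
  then obtain k l where kl: "k < 6" "l < 6" "k mod 3 \<noteq> l mod 3" "{g i, g j} = {g k, g l}"
    unfolding octahedron_def by auto
  then have "i = k \<and> j = l \<or> i = l \<and> j = k"
    using assms unfolding doubleton_eq_iff by (meson inj_onD lessThan_iff)
  then show "i mod 3 \<noteq> j mod 3" using kl by auto
qed (use assms in \<open>auto simp: octahedron_def\<close>)

lemma finite_simple_octahedron:
  assumes "inj_on g {..<6}"
  shows "finite_simple_graph (octahedron g)"
  unfolding finite_simple_graph_def octahedron_def
  using assms by (auto simp: card_2_iff inj_on_def)

text \<open>At least three vertices survive. Survivors that are not antipodal are adjacent, and an
  antipodal pair is joined through a third survivor, which is adjacent to both because residue
  classes modulo 3 have only two members.\<close>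

lemma k_connected_octahedron:
  assumes inj: "inj_on g {..<6}"
  shows "k_connected 4 (octahedron g)"
  unfolding k_connected_def
proof (intro conjI allI impI)
  have card6: "card (vertices (octahedron g)) = 6"
    using card_image[OF inj] unfolding octahedron_def by simp
  then show "4 < card (vertices (octahedron g))" by simp
  fix X assume X: "X \<subseteq> vertices (octahedron g) \<and> card X < 4"
  let ?H = "induced_subgraph (octahedron g) (vertices (octahedron g) - X)"
  have V: "vertices ?H = g ` {..<6} - X" unfolding induced_subgraph_def octahedron_def by simp
  have adj: "(g i, g j) \<in> adjacency ?H"
    if "i < 6" "j < 6" "i mod 3 \<noteq> j mod 3" "g i \<notin> X" "g j \<notin> X" for i j
    unfolding adjacency_induced_subgraph octahedron_edge_iff[OF inj that(1,2)]
    using that by (auto simp: octahedron_def)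
  have "\<not> vertices (octahedron g) \<subseteq> X"
  proof
    assume "vertices (octahedron g) \<subseteq> X"
    then have "X = vertices (octahedron g)" using X by blast
    then show False using X card6 by simp
  qed
  then have "vertices ?H \<noteq> {}" unfolding V by (simp add: octahedron_def)
  moreover have "(g i, g j) \<in> (adjacency ?H)\<^sup>*"
    if ij: "i < 6" "j < 6" "g i \<notin> X" "g j \<notin> X" for i j
  proof (cases "i mod 3 = j mod 3")
    case False
    then show ?thesis using adj ij by blast
  next
    case True
    show ?thesis
    proof (cases "i = j")
      case neq: False
      define N where "N = {k. k < 6 \<and> g k \<notin> X}"
      have fin: "finite N" "finite X"
        using X finite_subset[of X] unfolding N_def octahedron_def by auto
      have "vertices (octahedron g) \<subseteq> X \<union> g ` N" unfolding N_def octahedron_def by auto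
      then have "6 \<le> card (X \<union> g ` N)" using card6 fin by (metis card_mono finite_UnI finite_imageI)
      also have "\<dots> \<le> card X + card N"
        using card_Un_le[of X "g ` N"] card_image_le[OF fin(1), of g] by linarith
      finally have "2 < card N" using X by linarith
      then have "\<not> N \<subseteq> {i, j}" using card_mono[of "{i, j}" N] neq by auto
      then obtain k where k: "k < 6" "g k \<notin> X" "k \<noteq> i" "k \<noteq> j" unfolding N_def by blast
      have "k mod 3 \<noteq> i mod 3"
        using less_6_cases[OF k(1)] less_6_cases[OF ij(1)] less_6_cases[OF ij(2)] k(3,4) True neq
        by (elim disjE) simp_all
      then have "(g i, g k) \<in> adjacency ?H" "(g k, g j) \<in> adjacency ?H"
        using adj[of i k] adj[of k j] ij True k by auto
      then show ?thesis by (meson r_into_rtrancl rtrancl_trans)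
    qed simp
  qed
  ultimately show "connected_graph ?H" unfolding connected_graph_def V by auto
qed

lemma induced_subgraph_vertices:
  "finite_simple_graph G \<Longrightarrow> induced_subgraph G (vertices G) = G"
  unfolding finite_simple_graph_def induced_subgraph_def by (cases G) auto

lemma k_connected_imp_connected_graph:
  assumes "finite_simple_graph G" "k_connected k G" "0 < k"
  shows "connected_graph G"
  using k_connected_def[THEN iffD1, OF assms(2), THEN conjunct2, rule_format, of "{}"] assms(3)
    induced_subgraph_vertices[OF assms(1)] by simp

text \<open>Restricting to a triple deletes the other three vertices, fewer than four, so
  4-connectivity already makes it connected.\<close>

lemma T3_octahedron:
  assumes inj: "inj_on g {..<6}"
  shows "T3 (octahedron g) = {X. X \<subseteq> g ` {..<6} \<and> card X = 3}"
proof -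
  have "connected_graph (induced_subgraph (octahedron g) X)" if X: "X \<subseteq> g ` {..<6}" "card X = 3" for X
  proof -
    let ?V = "g ` {..<6}"
    have V: "vertices (octahedron g) = ?V" "card ?V = 6"
      using card_image[OF inj] unfolding octahedron_def by auto
    have "card (?V - X) < 4" using X V(2) by (simp add: card_Diff_subset finite_subset)
    then have "connected_graph (induced_subgraph (octahedron g) (?V - (?V - X)))"
      using k_connected_octahedron[OF inj] V(1) unfolding k_connected_def by auto
    then show ?thesis using X by (simp add: double_diff)
  qed
  then show ?thesis unfolding T3_def by (auto simp: octahedron_def)
qed

section \<open>A straight-line drawing of the octahedron\<close>

text \<open>This is the orientation determinant, twice the signed area of the triangle
  \<open>i j k\<close>: positive when \<open>k\<close> is to the left of the line from
  \<open>i\<close> to \<open>j\<close>, zero when it is on that line.\<close>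

definition side :: "int \<times> int \<Rightarrow> int \<times> int \<Rightarrow> int \<times> int \<Rightarrow> int" where
  "side i j k = (fst j - fst i) * (snd k - snd i) - (snd j - snd i) * (fst k - fst i)"

text \<open>A large triangle 0, 1, 2 contains a small inverted triangle 3, 4, 5, with
  \<open>i + 3\<close> facing the side opposite \<open>i\<close>. Integer coordinates let evaluation
  decide all the sign conditions.\<close>

definition oct_points :: "(int \<times> int) list" where
  "oct_points = [(0, 6), (-6, -4), (6, -4), (0, -2), (2, 1), (-2, 1)]"

definition oct_edges :: "(nat \<times> nat) list" where
  "oct_edges = [(0,1),(0,2),(0,4),(0,5),(1,2),(1,3),(1,5),(2,3),(2,4),(3,4),(3,5),(4,5)]"

definition oct_segments :: "((int \<times> int) \<times> (int \<times> int)) list" where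
  "oct_segments = map (\<lambda>(i, j). (oct_points ! i, oct_points ! j)) oct_edges"

text \<open>
  For any two edges some line through two of the six points has the first edge weakly on its
  positive side but not contained in it, and the second edge weakly on its negative side.
\<close>

lemma oct_separating_lines:
  "list_all (\<lambda>(a, b). list_all (\<lambda>(c, d). (a, b) = (c, d) \<or>
     list_ex (\<lambda>i. list_ex (\<lambda>j. side i j a \<ge> 0 \<and> side i j b \<ge> 0 \<and> side i j a + side i j b > 0 \<and>
        side i j c \<le> 0 \<and> side i j d \<le> 0) oct_points) oct_points) oct_segments) oct_segments"
  by code_simp

definition to_complex :: "int \<times> int \<Rightarrow> complex" where
  "to_complex k = Complex (of_int (fst k)) (of_int (snd k))"

text \<open>\<open>side i j\<close> extends to an affine function \<open>f\<close> on the plane. It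
  is at most 0 on the segment from \<open>c\<close> to \<open>d\<close>. Since its values at
  \<open>a\<close> and \<open>b\<close> are nonnegative and not both zero, it is strictly positive
  strictly between them.\<close>

lemma open_segment_avoids_segment:
  assumes "side i j a \<ge> 0" "side i j b \<ge> 0" "side i j a + side i j b > 0" "side i j c \<le> 0" "side i j d \<le> 0"
  shows "(closed_segment (to_complex a) (to_complex b) - {to_complex a, to_complex b}) \<inter>
    closed_segment (to_complex c) (to_complex d) = {}"
proof (rule ccontr)
  define f where "f z = (of_int (fst j) - of_int (fst i)) * (Im z - of_int (snd i)) -
    (of_int (snd j) - of_int (snd i)) * (Re z - of_int (fst i))" for z
  have f: "f (to_complex k) = of_int (side i j k)" for k
    unfolding f_def side_def to_complex_def by simp
  have aff: "f ((1 - t) *\<^sub>R z + t *\<^sub>R w) = (1 - t) * f z + t * f w" for t z w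
    unfolding f_def by (simp add: algebra_simps)
  assume "\<not> ?thesis"
  then obtain z where z: "z \<in> closed_segment (to_complex a) (to_complex b)"
    "z \<in> closed_segment (to_complex c) (to_complex d)" "z \<noteq> to_complex a" "z \<noteq> to_complex b"
    by blast
  obtain s where s01: "0 \<le> s" "s \<le> 1" and zs: "z = (1 - s) *\<^sub>R to_complex a + s *\<^sub>R to_complex b"
    using z(1) unfolding in_segment by blast
  obtain t where t01: "0 \<le> t" "t \<le> 1" and zt: "z = (1 - t) *\<^sub>R to_complex c + t *\<^sub>R to_complex d"
    using z(2) unfolding in_segment by blast
  have s: "0 < s" "s < 1" using s01 zs z(3,4) by (auto simp: less_le)
  have "(1 - s) * of_int (side i j a) + s * of_int (side i j b) =
      (1 - t) * of_int (side i j c) + t * of_int (side i j d)"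
    using arg_cong[OF trans[OF zs[symmetric] zt], of f] unfolding aff f .
  moreover have "(1 - t) * of_int (side i j c) + t * of_int (side i j d) \<le> 0"
    using t01 assms by (intro add_nonpos_nonpos mult_nonneg_nonpos) auto
  moreover have "0 < (1 - s) * of_int (side i j a) + s * of_int (side i j b)"
  proof (cases "side i j a = 0")
    case True
    then show ?thesis using s assms by simp
  next
    case False
    then show ?thesis using s assms by (intro add_pos_nonneg mult_pos_pos mult_nonneg_nonneg) auto
  qed
  ultimately show False by linarith
qed

lemma oct_edges_iff:
  assumes "i < 6" "j < 6"
  shows "(i, j) \<in> set oct_edges \<or> (j, i) \<in> set oct_edges \<longleftrightarrow> i mod 3 \<noteq> j mod 3"
  using assms[THEN less_6_cases] unfolding oct_edges_def by (elim disjE) simp_all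

lemma oct_edges_less: "(i, j) \<in> set oct_edges \<Longrightarrow> i < j \<and> j < 6"
  unfolding oct_edges_def by auto

lemma planar_octahedron:
  assumes inj: "inj_on g {..<6}"
  shows "planar (octahedron g)"
proof -
  define P where "P i = to_complex (oct_points ! i)" for i
  define p where "p v = P (inv_into {..<6} g v)" for v
  have p: "p (g i) = P i" if "i < 6" for i
    using inv_into_f_f[OF inj] that unfolding p_def by simp
  have pts: "i = j" if "i < 6" "j < 6" "oct_points ! i = oct_points ! j" for i j
    using that nth_eq_iff_index_eq[of oct_points i j] by (simp add: oct_points_def)
  have injP: "i = j" if "i < 6" "j < 6" "P i = P j" for i j
    using that pts[of i j] unfolding P_def to_complex_def by (simp add: prod_eq_iff)
  have "\<exists>i j. (i, j) \<in> set oct_edges \<and> e = {g i, g j}" if "e \<in> edges (octahedron g)" for e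
  proof -
    have "e \<in> {{g i, g j} | i j. i < 6 \<and> j < 6 \<and> i mod 3 \<noteq> j mod 3}"
      using that unfolding octahedron_def by simp
    then obtain i j where "i < 6" "j < 6" "i mod 3 \<noteq> j mod 3" "e = {g i, g j}" by blast
    then show ?thesis using oct_edges_iff[of i j] by (metis insert_commute)
  qed
  then obtain I J where IJ: "\<And>e. e \<in> edges (octahedron g) \<Longrightarrow> (I e, J e) \<in> set oct_edges \<and> e = {g (I e), g (J e)}"
    by metis
  define \<gamma> where "\<gamma> e = linepath (P (I e)) (P (J e))" for e
  have less: "I e < 6" "J e < 6" "I e \<noteq> J e" if "e \<in> edges (octahedron g)" for e
    using oct_edges_less[OF conjunct1[OF IJ[OF that]]] by simp_all
  have pe: "p ` e = {P (I e), P (J e)}" if "e \<in> edges (octahedron g)" for e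
    using arg_cong[OF conjunct2[OF IJ[OF that]], of "image p"] p less[OF that] by simp
  have apart: "(path_image (\<gamma> e) - p ` e) \<inter> path_image (\<gamma> e') = {}"
    if e: "e \<in> edges (octahedron g)" and e': "e' \<in> edges (octahedron g)" "e' \<noteq> e" for e e'
  proof -
    have seg: "(oct_points ! I e, oct_points ! J e) \<in> set oct_segments"
      if "e \<in> edges (octahedron g)" for e
      using conjunct1[OF IJ[OF that]] unfolding oct_segments_def by (auto intro: rev_image_eqI)
    have "(I e, J e) \<noteq> (I e', J e')" using conjunct2[OF IJ[OF e]] conjunct2[OF IJ[OF e'(1)]] e'(2) by auto
    then have "(oct_points ! I e, oct_points ! J e) \<noteq> (oct_points ! I e', oct_points ! J e')"
      using pts less[OF e] less[OF e'(1)] by auto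
    then obtain i j where "side i j (oct_points ! I e) \<ge> 0" "side i j (oct_points ! J e) \<ge> 0"
      "side i j (oct_points ! I e) + side i j (oct_points ! J e) > 0"
      "side i j (oct_points ! I e') \<le> 0" "side i j (oct_points ! J e') \<le> 0"
      using oct_separating_lines seg[OF e] seg[OF e'(1)]
      unfolding list_all_iff list_ex_iff by fastforce
    from open_segment_avoids_segment[OF this] show ?thesis
      unfolding pe[OF e] \<gamma>_def path_image_linepath P_def .
  qed
  \<comment> \<open>Every vertex lies on an edge other than \<open>e\<close>, so
    \<open>apart\<close> already keeps it out of the interior of \<open>e\<close>.\<close>
  have off: "(path_image (\<gamma> e) - p ` e) \<inter> p ` vertices (octahedron g) = {}"
    if e: "e \<in> edges (octahedron g)" for e
  proof -
    have "P k \<notin> path_image (\<gamma> e) - p ` e" if k: "k < 6" for k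
    proof -
      have edge: "{g k, g l} \<in> edges (octahedron g)" if "l < 6" "k mod 3 \<noteq> l mod 3" for l
        using that k unfolding octahedron_def by auto
      have "\<exists>l m. l < 6 \<and> m < 6 \<and> l \<noteq> m \<and> k mod 3 \<noteq> l mod 3 \<and> k mod 3 \<noteq> m mod 3"
        using less_6_cases[OF k] 
        \<comment> \<open>Reduction modulo 6 preserves residues modulo 3, so these two indices
          represent the two classes other than that of \<open>k\<close>.\<close>
        by (intro exI[of _ "(k + 1) mod 6"] exI[of _ "(k + 2) mod 6"]) (elim disjE; simp)
      then obtain l m where lm: "l < 6" "m < 6" "l \<noteq> m" "k mod 3 \<noteq> l mod 3" "k mod 3 \<noteq> m mod 3"
        by blast
      have "g l \<noteq> g m" using inj lm(1-3) by (auto dest: inj_onD)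
      then have "{g k, g l} \<noteq> e \<or> {g k, g m} \<noteq> e" by (auto simp: doubleton_eq_iff)
      then obtain n where n: "n < 6" "k mod 3 \<noteq> n mod 3" "{g k, g n} \<noteq> e" using lm by blast
      have "P k \<in> p ` {g k, g n}" using p[OF k] by simp
      then have "P k \<in> path_image (\<gamma> {g k, g n})"
        unfolding pe[OF edge[OF n(1,2)]] \<gamma>_def by auto
      then show ?thesis using apart[OF e edge[OF n(1,2)] n(3)] by blast
    qed
    then show ?thesis using p unfolding octahedron_def by auto
  qed
  have "inj_on p (vertices (octahedron g))"
    unfolding octahedron_def inj_on_def using p injP by auto
  moreover have "arc (\<gamma> e)" "{pathstart (\<gamma> e), pathfinish (\<gamma> e)} = p ` e"
    if "e \<in> edges (octahedron g)" for e
    using injP less[OF that] pe[OF that] unfolding \<gamma>_def by (auto intro!: arc_linepath)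
  ultimately have "plane_drawing (octahedron g) p \<gamma>"
    unfolding plane_drawing_def using apart off by blast
  then show ?thesis unfolding planar_def by blast
qed

lemma not_T3_reconstructible_planar_up_to_4:
  assumes "k \<le> 4"
  shows "\<not> T3_reconstructible (k_connected_planar_graphs k :: 'a::infinite graph set)"
proof -
  obtain g :: "nat \<Rightarrow> 'a" where "inj g"
    using infinite_countable_subset[OF infinite_UNIV] by blast
  then have g: "inj_on g {..<6}" by (rule inj_on_subset) simp
  \<comment> \<open>Swapping the labels 0 and 1 keeps the vertex set but moves the matching:
    \<open>g 0\<close> and \<open>g 3\<close> are antipodal for \<open>g\<close>, while for
    \<open>h\<close> they have indices 1 and 3 and are adjacent.\<close>
  define h where "h i = g (if i = 0 then 1 else if i = 1 then 0 else i)" for i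
  have h: "inj_on h {..<6}"
    using \<open>inj g\<close> unfolding h_def inj_on_def by (auto split: if_splits)
  have img: "h ` {..<6} = g ` {..<6}"
  proof
    show "h ` {..<6} \<subseteq> g ` {..<6}" unfolding h_def by auto
    have "g i = h (if i = 0 then 1 else if i = 1 then 0 else i)" for i unfolding h_def by simp
    then show "g ` {..<6} \<subseteq> h ` {..<6}" by auto
  qed
  have mem: "octahedron f \<in> k_connected_planar_graphs k" if "inj_on f {..<6}" for f :: "nat \<Rightarrow> 'a"
    unfolding k_connected_planar_graphs_def
    using finite_simple_octahedron[OF that] planar_octahedron[OF that]
      k_connected_mono[OF k_connected_octahedron[OF that] assms]
      k_connected_imp_connected_graph[OF finite_simple_octahedron[OF that] k_connected_octahedron[OF that]]
    by simp
  have "{g 0, g 3} \<notin> edges (octahedron g)" using octahedron_edge_iff[OF g, of 0 3] by simp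
  moreover have "{g 0, g 3} \<in> edges (octahedron h)"
    using octahedron_edge_iff[OF h, of 1 3] unfolding h_def by simp
  ultimately have "octahedron g \<noteq> octahedron h" by metis
  moreover have "T3 (octahedron g) = T3 (octahedron h)"
    using T3_octahedron[OF g] T3_octahedron[OF h] img by simp
  ultimately show ?thesis
    using mem[OF g] mem[OF h] unfolding T3_reconstructible_def by blast
qed

theorem theorem3p5:
  shows "(\<forall>k\<le>4. \<not> T3_reconstructible (k_connected_planar_graphs k :: 'a::infinite graph set)) \<and>
         T3_reconstructible (k_connected_planar_graphs 5 :: 'a graph set) \<and>
         (\<forall>k\<ge>6. \<not> (\<exists>G :: 'a graph. G \<in> k_connected_planar_graphs k))"
proof (intro conjI allI impI)
  show "\<not> T3_reconstructible (k_connected_planar_graphs k :: 'a graph set)" if "k \<le> 4" for k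
    using that by (rule not_T3_reconstructible_planar_up_to_4)
  show "T3_reconstructible (k_connected_planar_graphs 5 :: 'a graph set)"
    by (rule T3_reconstructible_5_connected_planar)
  show "\<not> (\<exists>G :: 'a graph. G \<in> k_connected_planar_graphs k)" if "k \<ge> 6" for k
    using not_6_connected_planar k_connected_mono[OF _ that]
    unfolding k_connected_planar_graphs_def by blast
qed

end
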